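(* Consider a two-armed Bernoulli bandit with means $0<\mu_2<\mu_1<1$. Let $(X_t)_{t\ge1}$ be a sequence of i.i.d. Bernoulli random variables with mean $\mu_2$, and for $T\ge1$ let $\sigma_T$ be the stopping time $$\sigma_T:=T\wedge\inf\left\{t\ge1:\ -\frac{\mu_1-\mu_2}{2}+\frac1t\sum_{i=1}^{t}(X_i-\mu_2)\le0\right\}.$$ Then for all $T\ge1$, the UCB policy satisfies $\mathrm{RegExp}(\mathrm{UCB};T)\ge(\mu_1-\mu_2)\,\mathbb E[\sigma_T]$.
   Context: Two-armed Bernoulli bandit: at each time $t\ge1$ the policy picks an arm $A_t\in\{1,2\}$ from the history $(A_1,R_1,\dots,A_{t-1},R_{t-1})$, then observes $R_t\in\{0,1\}$ which, given $A_t$, is Bernoulli with mean $\mu_{A_t}$, independent of the past and of the policy's internal randomness. $N_a(t):=\sum_{i=1}^{t-1}\mathbf 1(A_i=a)$ and $\hat\mu_a(t)$ is the empirical mean of the $N_a(t)$ rewards received from arm $a$ before time $t$. UCB: at time $t$, pull an arm maximizing the index $\hat\mu_a(t)+\sqrt{2\log(t)/N_a(t)}$, which is $+\infty$ by convention if $N_a(t)=0$. $\mathrm{Reg}(s;s+T):=\sum_{i=0}^{T-1}(\mu_1-\mu_{A_{s+i}})$. Exploration episodes: $\tau_1:=\inf\{t:A_t=2\}$, $\tau_{k+1}:=\inf\{t>\tau_k:A_t=2,\ A_{t-1}=1\}$. Regret of exploration: $\mathrm{RegExp}(T):=\limsup_{k\to\infty}\mathbb E[\mathrm{Reg}(\tau_k;\tau_k+T)]$.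 *)

theory Defs
  imports "HOL-Probability.Probability"
begin

(* Arms are the naturals 1 and 2 and time starts at 1; A 0 and R 0 play no role.
   A reward is a bool, read as a number in {0,1} through of_bool. *)

(* The sigma-algebra generated by the internal randomness U of the policy and by
   (A_1, R_1, ..., A_(t-1), R_(t-1)). *)
definition past ::
  "'w measure \<Rightarrow> 'u measure \<Rightarrow> ('w \<Rightarrow> 'u) \<Rightarrow> (nat \<Rightarrow> 'w \<Rightarrow> nat) \<Rightarrow> (nat \<Rightarrow> 'w \<Rightarrow> bool) \<Rightarrow> nat \<Rightarrow> 'w measure"
where
  "past M MU U A R t =
     vimage_algebra (space M) (\<lambda>\<omega>. (U \<omega>, \<lambda>i\<in>{1..<t}. (A i \<omega>, R i \<omega>)))
       (MU \<Otimes>\<^sub>M (\<Pi>\<^sub>M i\<in>{1..<t}. count_space {1, 2} \<Otimes>\<^sub>M count_space UNIV))"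

(* The interaction of an arbitrary (possibly randomized) policy with the bandit.
   A_t is past-measurable, so conditioning on the past and U includes conditioning on A_t;
   since rewards are binary, the last assumption fixes the whole conditional law of R_t:
   it is Bernoulli with mean \<mu> (A_t), whatever the past and U are. *)
locale two_armed_bernoulli_bandit = prob_space M
  for M :: "'w measure" +
  fixes MU :: "'u measure"
    and U :: "'w \<Rightarrow> 'u"
    and A :: "nat \<Rightarrow> 'w \<Rightarrow> nat"
    and R :: "nat \<Rightarrow> 'w \<Rightarrow> bool"
    and \<mu> :: "nat \<Rightarrow> real"
  assumes measurable_U: "U \<in> M \<rightarrow>\<^sub>M MU"
    and measurable_R: "\<And>t. t \<ge> 1 \<Longrightarrow> R t \<in> M \<rightarrow>\<^sub>M count_space UNIV"
    and measurable_A: "\<And>t. t \<ge> 1 \<Longrightarrow> A t \<in> past M MU U A R t \<rightarrow>\<^sub>M count_space {1, 2}"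
    and reward_bernoulli: "\<And>t. t \<ge> 1 \<Longrightarrow>
      AE \<omega> in M. real_cond_exp M (past M MU U A R t) (\<lambda>\<omega>. of_bool (R t \<omega>)) \<omega> = \<mu> (A t \<omega>)"

definition pulls :: "(nat \<Rightarrow> 'w \<Rightarrow> nat) \<Rightarrow> nat \<Rightarrow> nat \<Rightarrow> 'w \<Rightarrow> nat" where
  "pulls A a t \<omega> = card {i \<in> {1..<t}. A i \<omega> = a}"

definition emp_mean ::
  "(nat \<Rightarrow> 'w \<Rightarrow> nat) \<Rightarrow> (nat \<Rightarrow> 'w \<Rightarrow> bool) \<Rightarrow> nat \<Rightarrow> nat \<Rightarrow> 'w \<Rightarrow> real" where
  "emp_mean A R a t \<omega> = (\<Sum>i\<in>{i \<in> {1..<t}. A i \<omega> = a}. of_bool (R i \<omega>)) / real (pulls A a t \<omega>)"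

definition ucb_index ::
  "(nat \<Rightarrow> 'w \<Rightarrow> nat) \<Rightarrow> (nat \<Rightarrow> 'w \<Rightarrow> bool) \<Rightarrow> nat \<Rightarrow> 'w \<Rightarrow> nat \<Rightarrow> ereal" where
  "ucb_index A R t \<omega> a =
     (if pulls A a t \<omega> = 0 then \<infinity>
      else ereal (emp_mean A R a t \<omega> + sqrt (2 * ln (real t) / real (pulls A a t \<omega>))))"

(* Ties may be broken in any way, including with the help of U. *)
definition follows_UCB ::
  "'w measure \<Rightarrow> (nat \<Rightarrow> 'w \<Rightarrow> nat) \<Rightarrow> (nat \<Rightarrow> 'w \<Rightarrow> bool) \<Rightarrow> bool" where
  "follows_UCB M A R \<longleftrightarrow>
     (\<forall>\<omega>\<in>space M. \<forall>t\<ge>1. is_arg_max (ucb_index A R t \<omega>) (\<lambda>a. a \<in> {1, 2}) (A t \<omega>))"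

(* Reg(s; s + T) *)
definition regret :: "(nat \<Rightarrow> real) \<Rightarrow> (nat \<Rightarrow> 'w \<Rightarrow> nat) \<Rightarrow> nat \<Rightarrow> nat \<Rightarrow> 'w \<Rightarrow> real" where
  "regret \<mu> A s T \<omega> = (\<Sum>i<T. \<mu> 1 - \<mu> (A (s + i) \<omega>))"

(* tau A k is the start of the k-th exploration episode for k \<ge> 1 (infinite if there is none);
   the value at k = 0 is a dummy. *)
fun tau :: "(nat \<Rightarrow> 'w \<Rightarrow> nat) \<Rightarrow> nat \<Rightarrow> 'w \<Rightarrow> enat" where
  "tau A 0 \<omega> = 0"
| "tau A (Suc 0) \<omega> = Inf {enat t | t. t \<ge> 1 \<and> A t \<omega> = 2}"
| "tau A (Suc (Suc k)) \<omega> =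
     Inf {enat t | t. enat t > tau A (Suc k) \<omega> \<and> A t \<omega> = 2 \<and> A (t - 1) \<omega> = 1}"

(* On tau = \<infinity> the regret is counted as 0. Under UCB this does not occur, as both arms
   are pulled infinitely often; for \<mu> 2 \<le> \<mu> 1 it is the least possible value of the regret. *)
definition RegExp ::
  "'w measure \<Rightarrow> (nat \<Rightarrow> real) \<Rightarrow> (nat \<Rightarrow> 'w \<Rightarrow> nat) \<Rightarrow> nat \<Rightarrow> ereal" where
  "RegExp M \<mu> A T =
     limsup (\<lambda>k. ereal (\<integral>\<omega>. (case tau A k \<omega> of enat s \<Rightarrow> regret \<mu> A s T \<omega> | \<infinity> \<Rightarrow> 0) \<partial>M))"

(* min with T makes the enat finite, so the_enat is harmless *)
definition sigma_stop ::
  "(nat \<Rightarrow> real) \<Rightarrow> (nat \<Rightarrow> 'v \<Rightarrow> bool) \<Rightarrow> nat \<Rightarrow> 'v \<Rightarrow> nat" where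
  "sigma_stop \<mu> X T \<omega> = the_enat (min (enat T)
     (Inf {enat t | t. t \<ge> 1 \<and>
        - ((\<mu> 1 - \<mu> 2) / 2) + (1 / real t) * (\<Sum>i = 1..t. of_bool (X i \<omega>) - \<mu> 2) \<le> 0}))"

end

theory Submission
  imports Defs "HOL-Real_Asymp.Real_Asymp"
begin

text \<open>Let \<open>n\<close> be the number of pulls of arm 2 before the start \<open>s\<close> of a late exploration episode.
  The index of arm 2 has just overtaken that of arm 1, the empirical means are accurate and arm 1
  has been pulled far more often, so \<open>sqrt (2 ln s / n)\<close> is close to \<open>\<mu>\<^sub>1 - \<mu>\<^sub>2\<close>.
  After \<open>m\<close> further pulls of arm 2 with rewards \<open>x\<^sub>1, \<dots>, x\<^sub>m\<close>, its index has moved relative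
  to that of arm 1 by about \<open>(\<Sum> (x\<^sub>j - \<mu>\<^sub>2) - m (\<mu>\<^sub>1 - \<mu>\<^sub>2) / 2) / n\<close>, which is positive as long as
  the stopping rule of \<open>\<sigma>\<^sub>T\<close> has not triggered. Hence arm 2 is pulled at least \<open>\<sigma>\<^sub>T\<close> times in a row
  on an event that is determined before the episode, and whose probability tends to 1 by a
  strong law for each arm.\<close>

section \<open>UCB along a single sample path\<close>

text \<open>The half in the threshold comes from differentiating the bonus: when
  \<open>sqrt (2 ln s / n)\<close> is close to \<open>\<mu> 1 - \<mu> 2\<close>, one more pull
  lowers it by about \<open>(\<mu> 1 - \<mu> 2) / (2 n)\<close>, while a reward \<open>x\<close>
  moves the empirical mean by about \<open>(x - \<mu> 2) / n\<close>. Both effects have order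
  \<open>1 / n\<close>, so after scaling by \<open>n\<close> every error must stay below a fixed
  margin \<delta>. The obstacle is that the rewards of an episode begin at a random time and come
  from arm 2 only while the policy keeps to it, so they cannot simply be identified with
  \<open>X\<close>. Instead, finite reward patterns are compared. Along a pattern that has not
  triggered the stopping rule the next arm is forced to be 2, hence the next reward is Bernoulli
  with mean \<open>\<mu> 2\<close> given the past. The pattern therefore has exactly its i.i.d.
  weight, times the probability of a good start. Both expectations become sums over
  \<open>i < T\<close> of such weights.\<close>

locale ucb_path =
  fixes A :: "nat \<Rightarrow> 'w \<Rightarrow> nat" and R :: "nat \<Rightarrow> 'w \<Rightarrow> bool" and \<omega> :: 'w
  assumes arg_max: "t \<ge> 1 \<Longrightarrow> is_arg_max (ucb_index A R t \<omega>) (\<lambda>a. a \<in> {1, 2}) (A t \<omega>)"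

section \<open>Pull counts and reward sums, updated one time step at a time\<close>

lemma pulls_Suc:
  assumes "t \<ge> 1"
  shows "pulls A a (Suc t) \<omega> = pulls A a t \<omega> + of_bool (A t \<omega> = a)"
proof -
  have "{i \<in> {1..<Suc t}. A i \<omega> = a} =
      (if A t \<omega> = a then insert t {i \<in> {1..<t}. A i \<omega> = a} else {i \<in> {1..<t}. A i \<omega> = a})"
    using assms by (auto simp: less_Suc_eq)
  then show ?thesis by (auto simp: pulls_def)
qed

lemma pulls_mono: "s \<le> t \<Longrightarrow> pulls A a s \<omega> \<le> pulls A a t \<omega>"
  unfolding pulls_def by (rule card_mono) auto

lemma pulls_upto_one [simp]: "t \<le> 1 \<Longrightarrow> pulls A a t \<omega> = 0"
  by (simp add: pulls_def)

definition reward_sum ::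
  "(nat \<Rightarrow> 'w \<Rightarrow> nat) \<Rightarrow> (nat \<Rightarrow> 'w \<Rightarrow> bool) \<Rightarrow> nat \<Rightarrow> nat \<Rightarrow> 'w \<Rightarrow> real" where
  "reward_sum A R a t \<omega> = (\<Sum>i\<in>{i \<in> {1..<t}. A i \<omega> = a}. of_bool (R i \<omega>))"

lemma emp_mean_eq: "emp_mean A R a t \<omega> = reward_sum A R a t \<omega> / pulls A a t \<omega>"
  by (simp add: emp_mean_def reward_sum_def)

lemma reward_sum_Suc:
  assumes "t \<ge> 1"
  shows "reward_sum A R a (Suc t) \<omega> =
    reward_sum A R a t \<omega> + (if A t \<omega> = a then of_bool (R t \<omega>) else 0)"
proof -
  have "{i \<in> {1..<Suc t}. A i \<omega> = a} =
      (if A t \<omega> = a then insert t {i \<in> {1..<t}. A i \<omega> = a} else {i \<in> {1..<t}. A i \<omega> = a})"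
    using assms by (auto simp: less_Suc_eq)
  then show ?thesis by (auto simp: reward_sum_def)
qed

lemma reward_sum_bounds: "0 \<le> reward_sum A R a t \<omega>" "reward_sum A R a t \<omega> \<le> pulls A a t \<omega>"
proof -
  show "0 \<le> reward_sum A R a t \<omega>" unfolding reward_sum_def by (rule sum_nonneg) auto
  have "reward_sum A R a t \<omega> \<le> (\<Sum>i\<in>{i \<in> {1..<t}. A i \<omega> = a}. 1)"
    unfolding reward_sum_def by (rule sum_mono) auto
  then show "reward_sum A R a t \<omega> \<le> pulls A a t \<omega>" by (simp add: pulls_def)
qed

lemma emp_mean_bounds: "0 \<le> emp_mean A R a t \<omega>" "emp_mean A R a t \<omega> \<le> 1"
  using reward_sum_bounds[where A=A and R=R and a=a and t=t and \<omega>=\<omega>]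
  by (auto simp: emp_mean_eq divide_le_eq_1)

context ucb_path
begin

lemma arm_cases: "t \<ge> 1 \<Longrightarrow> A t \<omega> = 1 \<or> A t \<omega> = 2"
  using arg_max[of t] by (auto simp: is_arg_max_def)

lemma pulls_add: "pulls A 1 t \<omega> + pulls A 2 t \<omega> = t - 1"
proof (induction t)
  case (Suc t)
  show ?case
  proof (cases "t = 0")
    case False
    then have "t \<ge> 1" by simp
    with Suc arm_cases[OF this] show ?thesis by (auto simp: pulls_Suc)
  qed simp
qed simp

text \<open>A chosen arm with finite index rules out the index \<infinity> for the other arm, so the
  comparison descends from \<open>ereal\<close> to real numbers.\<close>

lemma index_le:
  assumes "t \<ge> 1" "A t \<omega> = b" "a \<in> {1, 2}" "pulls A b t \<omega> > 0"
  shows "pulls A a t \<omega> > 0"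
    and "emp_mean A R a t \<omega> + sqrt (2 * ln (real t) / real (pulls A a t \<omega>))
      \<le> emp_mean A R b t \<omega> + sqrt (2 * ln (real t) / real (pulls A b t \<omega>))"
proof -
  have "\<not> ucb_index A R t \<omega> b < ucb_index A R t \<omega> a"
    using arg_max[OF assms(1)] assms(2,3) by (auto simp: is_arg_max_def)
  then have *: "ucb_index A R t \<omega> a \<le> ucb_index A R t \<omega> b" by simp
  show "pulls A a t \<omega> > 0"
    by (rule ccontr) (use * assms in \<open>simp add: ucb_index_def\<close>)
  with * assms show "emp_mean A R a t \<omega> + sqrt (2 * ln (real t) / real (pulls A a t \<omega>))
      \<le> emp_mean A R b t \<omega> + sqrt (2 * ln (real t) / real (pulls A b t \<omega>))"
    by (simp add: ucb_index_def)
qed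

lemma arm_if_index_greater:
  assumes "t \<ge> 1" "a \<in> {1, 2}" "b \<in> {1, 2}" "a \<noteq> b"
    and "pulls A a t \<omega> > 0" "pulls A b t \<omega> > 0"
    and "emp_mean A R a t \<omega> + sqrt (2 * ln (real t) / real (pulls A a t \<omega>))
      < emp_mean A R b t \<omega> + sqrt (2 * ln (real t) / real (pulls A b t \<omega>))"
  shows "A t \<omega> = b"
proof (rule ccontr)
  assume "A t \<omega> \<noteq> b"
  then have "A t \<omega> = a" using arm_cases[OF assms(1)] assms(2-4) by auto
  from index_le(2)[OF assms(1) this assms(3,5)] assms(7) show False by simp
qed

text \<open>An arm abandoned forever keeps a frozen count, so its bonus grows like
  \<open>sqrt (ln t)\<close>, while the index of the other arm stays bounded.\<close>

lemma exists_pull: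
  assumes "a \<in> {1, 2}"
  shows "\<exists>t\<ge>s. A t \<omega> = a"
proof (rule ccontr)
  assume neg: "\<not> (\<exists>t\<ge>s. A t \<omega> = a)"
  define b where "b = 3 - a"
  have ab: "b \<in> {1, 2}" "a \<noteq> b" using assms by (auto simp: b_def)
  define s' where "s' = Suc s"
  have not_a: "A t \<omega> \<noteq> a" if "t \<ge> s'" for t using neg that by (auto simp: s'_def)
  have is_b: "A t \<omega> = b" if "t \<ge> s'" for t
    using arm_cases[of t] not_a[OF that] that assms by (auto simp: s'_def b_def)
  define c where "c = pulls A a s' \<omega>"
  have const: "pulls A a t \<omega> = c" if "t \<ge> s'" for t
    using that
  proof (induction t rule: dec_induct)
    case base show ?case by (simp add: c_def)
  next
    case (step t)
    then show ?case using not_a[of t] by (subst pulls_Suc) (auto simp: s'_def)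
  qed
  have pb: "pulls A b t \<omega> = t - 1 - c" if "t \<ge> s'" for t
    using pulls_add[of t] const[OF that] assms by (auto simp: b_def)
  \<comment> \<open>The left side bounds the index of \<open>b\<close> from above, the right side
    the bonus of \<open>a\<close> from below. Writing \<open>real c + 1\<close> keeps the
    denominator positive also for \<open>c = 0\<close>; that \<open>c > 0\<close> is learnt only
    from \<open>index_le\<close>.\<close>
  have "eventually (\<lambda>t::nat. 1 + sqrt (2 * ln (real t) / (real t - 1 - real c))
      < sqrt (2 * ln (real t) / (real c + 1))) at_top"
    by real_asymp
  moreover have "eventually (\<lambda>t. t \<ge> s' + c + 2) at_top" by (rule eventually_ge_at_top)
  ultimately have "eventually (\<lambda>t::nat. False) at_top"
  proof eventually_elim
    case (elim t)
    then have t: "t \<ge> s'" "t \<ge> 1" by auto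
    have pbt: "real (pulls A b t \<omega>) = real t - 1 - real c" "pulls A b t \<omega> > 0"
      using pb[OF t(1)] elim by auto
    have I: "pulls A a t \<omega> > 0" "emp_mean A R a t \<omega> + sqrt (2 * ln (real t) / real (pulls A a t \<omega>))
      \<le> emp_mean A R b t \<omega> + sqrt (2 * ln (real t) / real (pulls A b t \<omega>))"
      using index_le[OF t(2) is_b[OF t(1)] assms(1) pbt(2)] by auto
    have "sqrt (2 * ln (real t) / (real c + 1)) \<le> sqrt (2 * ln (real t) / real (pulls A a t \<omega>))"
      using I(1) const[OF t(1)] t by (intro real_sqrt_le_mono divide_left_mono) auto
    then show False
      using I(2)[unfolded pbt(1)] elim(1) emp_mean_bounds(1)[of A R a t \<omega>]
        emp_mean_bounds(2)[of A R b t \<omega>] by linarith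
  qed
  then show False by simp
qed

lemma filterlim_pulls:
  assumes "a \<in> {1, 2}"
  shows "filterlim (\<lambda>t. pulls A a t \<omega>) at_top at_top"
proof -
  have "\<exists>t. pulls A a t \<omega> \<ge> n" for n
  proof (induction n)
    case (Suc n)
    then obtain t where t: "pulls A a t \<omega> \<ge> n" by blast
    obtain r where r: "r \<ge> Suc t" "A r \<omega> = a" using exists_pull[OF assms, of "Suc t"] by auto
    have "pulls A a (Suc r) \<omega> \<ge> Suc n"
      using r t pulls_mono[of t r A a \<omega>] by (simp add: pulls_Suc)
    then show ?case by blast
  qed simp
  then show ?thesis
    unfolding filterlim_at_top eventually_at_top_linorder
    by (meson order_trans pulls_mono)
qed

text \<open>An arm-2 pull at time \<open>s\<close> forces \<open>sqrt (2 ln s / N\<^sub>2) \<ge> (\<mu>\<^sub>1 - \<mu>\<^sub>2) / 2\<close> once the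
  empirical means are accurate.\<close>

lemma pulls_suboptimal_log:
  assumes conv: "\<And>a. a \<in> {1, 2} \<Longrightarrow> ((\<lambda>t. emp_mean A R a t \<omega>) \<longlongrightarrow> \<mu> a) at_top"
    and gap: "\<mu> 2 < (\<mu> 1 :: real)"
  shows "eventually (\<lambda>t. real (pulls A 2 t \<omega>) \<le> 8 / (\<mu> 1 - \<mu> 2)\<^sup>2 * ln (real t) + 1) at_top"
proof -
  let ?D = "\<mu> 1 - \<mu> 2"
  have "eventually (\<lambda>t. \<mu> 1 - ?D / 4 < emp_mean A R 1 t \<omega>) at_top"
    using order_tendstoD(1)[OF conv[of 1]] gap by simp
  moreover have "eventually (\<lambda>t. emp_mean A R 2 t \<omega> < \<mu> 2 + ?D / 4) at_top"
    using order_tendstoD(2)[OF conv[of 2]] gap by simp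
  moreover have "eventually (\<lambda>t. pulls A 2 t \<omega> \<ge> 1) at_top"
    using filterlim_pulls[of 2] by (simp add: filterlim_at_top)
  ultimately have "eventually (\<lambda>s. s \<ge> 1 \<and> \<mu> 1 - ?D / 4 < emp_mean A R 1 s \<omega> \<and>
      emp_mean A R 2 s \<omega> < \<mu> 2 + ?D / 4 \<and> pulls A 2 s \<omega> \<ge> 1) at_top"
    using eventually_ge_at_top[of 1] by eventually_elim auto
  then obtain s0 where s0: "\<And>s. s \<ge> s0 \<Longrightarrow> s \<ge> 1 \<and> \<mu> 1 - ?D / 4 < emp_mean A R 1 s \<omega> \<and>
      emp_mean A R 2 s \<omega> < \<mu> 2 + ?D / 4 \<and> pulls A 2 s \<omega> \<ge> 1"
    by (auto simp: eventually_at_top_linorder)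
  \<comment> \<open>Errors of \<open>?D / 4\<close> in each mean leave half the gap to the bonus of
    arm 2; squaring \<open>?D / 2 \<le> sqrt (2 * ln s / n)\<close> produces the constant 8.\<close>
  have key: "real (pulls A 2 s \<omega>) \<le> 8 / ?D\<^sup>2 * ln (real s)" if s: "s \<ge> s0" "A s \<omega> = 2" for s
  proof -
    let ?n = "real (pulls A 2 s \<omega>)"
    have n: "?n \<ge> 1" "s \<ge> 1" using s0[OF s(1)] by auto
    have "emp_mean A R 1 s \<omega> + sqrt (2 * ln (real s) / real (pulls A 1 s \<omega>))
        \<le> emp_mean A R 2 s \<omega> + sqrt (2 * ln (real s) / ?n)"
      using index_le(2)[of s 2 1] s n by auto
    moreover have "sqrt (2 * ln (real s) / real (pulls A 1 s \<omega>)) \<ge> 0" using n by simp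
    moreover have "\<mu> 1 - ?D / 4 < emp_mean A R 1 s \<omega>" "emp_mean A R 2 s \<omega> < \<mu> 2 + ?D / 4"
      using s0[OF s(1)] by auto
    moreover have "?D / 2 \<le> z" if "e1 + y \<le> e2 + z" "0 \<le> y" "\<mu> 1 - ?D / 4 < e1" "e2 < \<mu> 2 + ?D / 4"
      for e1 e2 y z :: real
      using that by (simp add: field_simps)
    ultimately have "?D / 2 \<le> sqrt (2 * ln (real s) / ?n)"
      by blast
    then have "(?D / 2)\<^sup>2 \<le> (sqrt (2 * ln (real s) / ?n))\<^sup>2"
      using gap by (intro power_mono) auto
    then have "(?D / 2)\<^sup>2 \<le> 2 * ln (real s) / ?n"
      using n by simp
    moreover have "k \<le> 8 / d\<^sup>2 * l" if "(d / 2)\<^sup>2 \<le> 2 * l / k" "k \<ge> 1" "d > 0" for d k l :: real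
      using that by (simp add: field_simps power2_eq_square)
    ultimately show ?thesis using n gap by simp
  qed
  define K where "K = pulls A 2 s0 \<omega>"
  have "eventually (\<lambda>t. pulls A 2 t \<omega> \<ge> Suc K) at_top"
    using filterlim_pulls[of 2] by (simp add: filterlim_at_top del: One_nat_def)
  moreover have "eventually (\<lambda>t. t \<ge> Suc s0) at_top" by (rule eventually_ge_at_top)
  ultimately show ?thesis
  proof eventually_elim
    case (elim t)
    \<comment> \<open>The count grows only at pulls of arm 2, where \<open>key\<close> bounds it
      just before the pull; the \<open>+ 1\<close> is that pull. The alternative
      \<open>\<le> K\<close> covers the start of the induction and is excluded for large
      \<open>t\<close>.\<close>
    have "pulls A 2 t \<omega> \<le> K \<or> real (pulls A 2 t \<omega>) \<le> 8 / ?D\<^sup>2 * ln (real t) + 1"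
      using elim(2)[THEN Suc_leD]
    proof (induction t rule: dec_induct)
      case base show ?case by (simp add: K_def)
    next
      case (step t)
      have t: "t \<ge> 1" using s0[OF step(1)] by simp
      have ln: "8 / ?D\<^sup>2 * ln (real t) \<le> 8 / ?D\<^sup>2 * ln (real (Suc t))"
        using t by (intro mult_left_mono) auto
      show ?case
      proof (cases "A t \<omega> = 2")
        case True
        then show ?thesis using key[OF step(1)] t ln by (simp add: pulls_Suc)
      next
        case False
        then show ?thesis using step.IH t ln by (auto simp: pulls_Suc)
      qed
    qed
    then show ?case using elim by auto
  qed
qed

end

section \<open>Late exploration episodes\<close>

text \<open>Every conjunct concerns rounds before \<open>s\<close>, so the event lies in the past of
  \<open>s\<close>. The surplus \<open>T\<close> of arm 1 keeps it the more pulled arm during the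
  next \<open>T\<close> rounds, and the factor \<open>1 + T / n\<close> absorbs the change of
  denominator from \<open>n\<close> to \<open>n + m\<close>.\<close>

definition good_time ::
  "(nat \<Rightarrow> real) \<Rightarrow> nat \<Rightarrow> real \<Rightarrow> (nat \<Rightarrow> 'w \<Rightarrow> nat) \<Rightarrow> (nat \<Rightarrow> 'w \<Rightarrow> bool) \<Rightarrow> nat \<Rightarrow> 'w \<Rightarrow> bool"
where
  "good_time \<mu> T \<epsilon> A R s \<omega> \<longleftrightarrow>
     pulls A 2 s \<omega> \<ge> 1 \<and> pulls A 1 s \<omega> \<ge> pulls A 2 s \<omega> + T \<and>
     \<bar>emp_mean A R 2 s \<omega> - \<mu> 2\<bar> \<le> \<epsilon> \<and>
     sqrt (2 * ln (real s) / real (pulls A 2 s \<omega>)) * (1 + real T / real (pulls A 2 s \<omega>))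
       \<le> \<mu> 1 - \<mu> 2 + \<epsilon>"

text \<open>The upper bound on the bonus of arm 2 comes from the pull of arm 1 at
  \<open>s - 1\<close>: there that bonus was at most the difference of the means plus the bonus of
  arm 1, which vanishes because arm 2 has only logarithmically many pulls.\<close>

lemma (in ucb_path) eventually_good_time:
  assumes conv: "\<And>a. a \<in> {1, 2} \<Longrightarrow> ((\<lambda>t. emp_mean A R a t \<omega>) \<longlongrightarrow> \<mu> a) at_top"
    and gap: "\<mu> 2 < (\<mu> 1 :: real)" and \<epsilon>: "\<epsilon> > 0"
  shows "eventually (\<lambda>s. A s \<omega> = 2 \<longrightarrow> A (s - 1) \<omega> = 1 \<longrightarrow> good_time \<mu> T \<epsilon> A R s \<omega>) at_top"
proof -
  define C where "C = 8 / (\<mu> 1 - \<mu> 2)\<^sup>2"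
  have C: "C > 0" using gap by (simp add: C_def)
  have N2: "eventually (\<lambda>t. real (pulls A 2 t \<omega>) \<le> C * ln (real t) + 1) at_top"
    unfolding C_def by (rule pulls_suboptimal_log[OF conv gap])
  have N1: "eventually (\<lambda>t. real (pulls A 1 t \<omega>) \<ge> real t - 2 - C * ln (real t)) at_top"
    using N2 eventually_ge_at_top[of 1]
  proof eventually_elim
    case (elim t)
    have "real (pulls A 1 t \<omega>) + real (pulls A 2 t \<omega>) = real t - 1"
      using pulls_add[of t] elim(2) by linarith
    with elim(1) show ?case by linarith
  qed
  have bonus1: "((\<lambda>t. sqrt (2 * ln (real t) / real (pulls A 1 t \<omega>))) \<longlongrightarrow> 0) at_top"
  proof (rule tendsto_sandwich[OF _ _ tendsto_const])
    show "((\<lambda>t::nat. sqrt (2 * ln (real t) / (real t - 2 - C * ln (real t)))) \<longlongrightarrow> 0) at_top"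
      by real_asymp
    show "eventually (\<lambda>t. 0 \<le> sqrt (2 * ln (real t) / real (pulls A 1 t \<omega>))) at_top"
      using eventually_ge_at_top[of 1] by eventually_elim auto
    have "eventually (\<lambda>t::nat. real t - 2 - C * ln (real t) > 0) at_top" by real_asymp
    then show "eventually (\<lambda>t. sqrt (2 * ln (real t) / real (pulls A 1 t \<omega>))
        \<le> sqrt (2 * ln (real t) / (real t - 2 - C * ln (real t)))) at_top"
      using N1 eventually_ge_at_top[of 1]
    proof eventually_elim
      case (elim t)
      then show ?case by (intro real_sqrt_le_mono divide_left_mono mult_pos_pos) auto
    qed
  qed
  have N2_real: "filterlim (\<lambda>t. real (pulls A 2 t \<omega>)) at_top at_top"
    by (rule filterlim_compose[OF filterlim_real_sequentially filterlim_pulls]) simp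
  \<comment> \<open>Here \<open>r\<close> stands for \<open>s - 1\<close>. The term
    \<open>sqrt (2 / n)\<close> pays for the growth of the logarithm from \<open>r\<close> to
    \<open>Suc r\<close>; the count of arm 2 is the same at both times.\<close>
  have lim: "((\<lambda>r. (emp_mean A R 1 r \<omega> - emp_mean A R 2 r \<omega> +
        sqrt (2 * ln (real r) / real (pulls A 1 r \<omega>)) + sqrt (2 / real (pulls A 2 r \<omega>)))
      * (1 + real T / real (pulls A 2 r \<omega>))) \<longlongrightarrow> (\<mu> 1 - \<mu> 2 + 0 + sqrt 0) * (1 + 0)) at_top"
    by (intro tendsto_intros conv bonus1 real_tendsto_divide_at_top[OF tendsto_const N2_real]) auto
  have "eventually (\<lambda>r. (emp_mean A R 1 r \<omega> - emp_mean A R 2 r \<omega> +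
        sqrt (2 * ln (real r) / real (pulls A 1 r \<omega>)) + sqrt (2 / real (pulls A 2 r \<omega>)))
      * (1 + real T / real (pulls A 2 r \<omega>)) < \<mu> 1 - \<mu> 2 + \<epsilon>) at_top"
    using order_tendstoD(2)[OF lim, of "\<mu> 1 - \<mu> 2 + \<epsilon>"] \<epsilon> by simp
  moreover have "eventually (\<lambda>r. \<bar>emp_mean A R 2 (Suc r) \<omega> - \<mu> 2\<bar> < \<epsilon>) at_top"
    using tendstoD[OF conv[of 2] \<epsilon>]
    by (subst eventually_sequentially_Suc) (simp add: dist_real_def)
  moreover have "eventually (\<lambda>r. pulls A 2 r \<omega> \<ge> 1) at_top"
    using filterlim_pulls[of 2] by (simp add: filterlim_at_top)
  moreover have "eventually (\<lambda>t::nat. real t - 2 - C * ln (real t) > C * ln (real t) + 1 + real T) at_top"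
    by real_asymp
  ultimately have "eventually (\<lambda>r. A (Suc r) \<omega> = 2 \<longrightarrow> A (Suc r - 1) \<omega> = 1 \<longrightarrow>
      good_time \<mu> T \<epsilon> A R (Suc r) \<omega>) at_top"
    using N1 N2 eventually_ge_at_top[of 1]
  proof eventually_elim
    case (elim r)
    show ?case
    proof (intro impI)
      assume "A (Suc r) \<omega> = 2" "A (Suc r - 1) \<omega> = 1"
      then have A1: "A r \<omega> = 1" by simp
      let ?n = "real (pulls A 2 r \<omega>)"
      have n: "?n \<ge> 1" "real r \<ge> 1" using elim by auto
      have N: "pulls A 2 (Suc r) \<omega> = pulls A 2 r \<omega>" "pulls A 1 (Suc r) \<omega> = pulls A 1 r \<omega> + 1"
        using A1 elim by (auto simp: pulls_Suc)
      have N12: "real (pulls A 1 r \<omega>) > real (pulls A 2 r \<omega>) + real T" using elim by linarith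
      then have "pulls A 1 r \<omega> > 0" by linarith
      from index_le(2)[OF _ A1 _ this, of 2] elim
      have "sqrt (2 * ln (real r) / ?n)
          \<le> emp_mean A R 1 r \<omega> - emp_mean A R 2 r \<omega> + sqrt (2 * ln (real r) / real (pulls A 1 r \<omega>))"
        by simp
      moreover have "sqrt (2 * ln (real (Suc r)) / ?n) \<le> sqrt (2 * ln (real r) / ?n) + sqrt (2 / ?n)"
      proof -
        have "ln (real r + 1) - ln (real r) \<le> (real r + 1 - real r) / real r"
          by (rule ln_diff_le) (use n in auto)
        also have "\<dots> \<le> 1" using n by simp
        finally have "2 * ln (real (Suc r)) / ?n \<le> 2 * ln (real r) / ?n + 2 / ?n"
          using n by (simp add: field_simps)
        then have "sqrt (2 * ln (real (Suc r)) / ?n) \<le> sqrt (2 * ln (real r) / ?n + 2 / ?n)"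
          by (rule real_sqrt_le_mono)
        also have "\<dots> \<le> sqrt (2 * ln (real r) / ?n) + sqrt (2 / ?n)"
          by (rule sqrt_add_le_add_sqrt) (use n in auto)
        finally show ?thesis .
      qed
      ultimately have "sqrt (2 * ln (real (Suc r)) / ?n) * (1 + real T / ?n) \<le>
         (emp_mean A R 1 r \<omega> - emp_mean A R 2 r \<omega> +
          sqrt (2 * ln (real r) / real (pulls A 1 r \<omega>)) + sqrt (2 / ?n)) * (1 + real T / ?n)"
        by (intro mult_right_mono) (use n in auto)
      then show "good_time \<mu> T \<epsilon> A R (Suc r) \<omega>"
        using elim N N12 by (simp add: good_time_def)
    qed
  qed
  then show ?thesis by (subst (asm) eventually_sequentially_Suc)
qed

text \<open>Convexity of \<open>g / sqrt z\<close> in \<open>z\<close>: the graph lies above its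
  tangent at \<open>z = a\<^sup>2\<close>. The 2 in the denominator is the source of the half in the
  stopping threshold.\<close>

lemma inverse_sqrt_diff_le:
  fixes a b g :: real
  assumes "0 < a" "a \<le> b" "0 \<le> g"
  shows "g / a - g / b \<le> g / a * ((b\<^sup>2 - a\<^sup>2) / (2 * a\<^sup>2))"
proof -
  have "2 * a\<^sup>2 \<le> (b + a) * b"
  proof -
    have "a * a \<le> a * b" "a * a \<le> b * b" using assms by (auto intro: mult_left_mono mult_mono)
    then show ?thesis by (simp add: power2_eq_square algebra_simps)
  qed
  then have "2 * a\<^sup>2 * (b - a) \<le> (b + a) * b * (b - a)" using assms by (intro mult_right_mono) auto
  then have "(b - a) / b \<le> (b\<^sup>2 - a\<^sup>2) / (2 * a\<^sup>2)"
    using assms by (simp add: field_simps power2_eq_square)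
  then have "g / a * ((b - a) / b) \<le> g / a * ((b\<^sup>2 - a\<^sup>2) / (2 * a\<^sup>2))"
    using assms by (intro mult_left_mono) auto
  moreover have "g / a * ((b - a) / b) = g / a - g / b" using assms by (simp add: field_simps)
  ultimately show ?thesis by simp
qed

text \<open>Here \<open>g\<close>, \<open>g'\<close> are \<open>sqrt (2 ln s)\<close> and \<open>sqrt (2 ln (s + m))\<close>, and \<open>x\<close> is the sum of the
  \<open>m\<close> rewards collected from arm 2 since time \<open>s\<close>. Multiplied by \<open>n + m\<close>, the gap between the two
  indices is at least \<open>(x - m * p - m * d) - 3 / 2 * m * \<epsilon>\<close>.\<close>

lemma index_gap_positive:
  fixes n m N g g' S x p d \<delta> \<epsilon> T e1 :: real
  assumes n: "n > 0" and m: "0 \<le> m" "m \<le> T" and N: "n + m \<le> N" and g: "0 \<le> g" "g \<le> g'"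
    and le: "e1 + g / sqrt N \<le> S / n + g / sqrt n"
    and mean: "\<bar>S / n - p\<bar> \<le> \<epsilon>"
    and bonus: "g / sqrt n * (1 + T / n) \<le> 2 * d + \<epsilon>"
    and x: "m * d + \<delta> \<le> x - m * p"
    and \<epsilon>: "3 / 2 * T * \<epsilon> < \<delta>"
  shows "e1 + g' / sqrt N < (S + x) / (n + m) + g' / sqrt (n + m)"
proof -
  \<comment> \<open>The growth of the logarithm favours the arm with fewer pulls, so
    \<open>g'\<close> may be replaced by \<open>g\<close>.\<close>
  have "g * (1 / sqrt (n + m) - 1 / sqrt N) \<le> g' * (1 / sqrt (n + m) - 1 / sqrt N)"
    using g n m N by (intro mult_right_mono) (auto simp: frac_le)
  then have A: "g' / sqrt N - g' / sqrt (n + m) \<le> g / sqrt N - g / sqrt (n + m)"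
    by (simp add: algebra_simps)
  have "g / sqrt n - g / sqrt (n + m) \<le> g / sqrt n * (((sqrt (n + m))\<^sup>2 - (sqrt n)\<^sup>2) / (2 * (sqrt n)\<^sup>2))"
    by (rule inverse_sqrt_diff_le) (use n m g in auto)
  also have "\<dots> = g / sqrt n * (m / (2 * n))" using n m by simp
  \<comment> \<open>Bringing the tangent bound over the denominator \<open>n + m\<close> creates the
    factor \<open>1 + m / n\<close>, which \<open>bonus\<close> controls through
    \<open>m \<le> T\<close>.\<close>
  also have "\<dots> = g / sqrt n * (1 + m / n) * (m / 2) / (n + m)"
  proof -
    have "m / (2 * n) = (1 + m / n) * (m / 2) / (n + m)" using n m by (simp add: divide_simps)
    then show ?thesis by (simp only: mult.assoc times_divide_eq_right)
  qed
  also have "\<dots> \<le> (2 * d + \<epsilon>) * (m / 2) / (n + m)"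
  proof -
    have "g / sqrt n * (1 + m / n) \<le> g / sqrt n * (1 + T / n)"
      using g n m by (intro mult_left_mono add_left_mono divide_right_mono) auto
    with bonus have "g / sqrt n * (1 + m / n) \<le> 2 * d + \<epsilon>" by linarith
    then show ?thesis using m n by (intro divide_right_mono mult_right_mono) auto
  qed
  finally have B: "g / sqrt n - g / sqrt (n + m) \<le> (2 * d + \<epsilon>) * (m / 2) / (n + m)" .
  have "m * (S / n) \<le> m * (p + \<epsilon>)" using mean m by (intro mult_left_mono) auto
  then have "m * d + \<delta> - m * \<epsilon> \<le> x - m * (S / n)" using x by (simp add: algebra_simps)
  moreover have "(S + x) / (n + m) - S / n = (x - m * (S / n)) / (n + m)"
    using n m by (simp add: divide_simps) (simp add: algebra_simps)
  ultimately have C: "(m * d + \<delta> - m * \<epsilon>) / (n + m) \<le> (S + x) / (n + m) - S / n"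
    using n m by (simp add: divide_right_mono)
  \<comment> \<open>The total error is \<open>m * \<epsilon> / 2\<close> from the bonus plus
    \<open>m * \<epsilon>\<close> from the empirical mean, hence the factor
    \<open>3 / 2\<close>.\<close>
  have "0 \<le> \<epsilon>" using mean by linarith
  then have "3 / 2 * m * \<epsilon> \<le> 3 / 2 * T * \<epsilon>" using m by (intro mult_right_mono) auto
  then have "(2 * d + \<epsilon>) * (m / 2) < m * d + \<delta> - m * \<epsilon>" using \<epsilon> by (simp add: algebra_simps)
  then have "(2 * d + \<epsilon>) * (m / 2) / (n + m) < (m * d + \<delta> - m * \<epsilon>) / (n + m)"
    using n m by (intro divide_strict_right_mono) auto
  then show ?thesis using A B C le by linarith
qed

text \<open>The stopping rule multiplied by \<open>l\<close> and negated for all \<open>l\<close> up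
  to \<open>i\<close>; for \<open>i < T\<close> this says that \<open>sigma_stop\<close> exceeds
  \<open>i\<close>. The sequence is indexed from 0, so \<open>y j\<close> is reward number
  \<open>j + 1\<close>, and \<open>i = 0\<close> holds vacuously.\<close>

definition stays_above :: "real \<Rightarrow> real \<Rightarrow> (nat \<Rightarrow> bool) \<Rightarrow> nat \<Rightarrow> bool" where
  "stays_above p d y i \<longleftrightarrow> (\<forall>l\<in>{1..i}. real l * d < (\<Sum>j<l. of_bool (y j)) - real l * p)"

lemma stays_above_mono: "stays_above p d y i \<Longrightarrow> j \<le> i \<Longrightarrow> stays_above p d y j"
  by (auto simp: stays_above_def)

lemma stays_above_cong:
  "(\<And>j. j < i \<Longrightarrow> y j = z j) \<Longrightarrow> stays_above p d y i \<longleftrightarrow> stays_above p d z i"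
  unfolding stays_above_def
  by (intro ball_cong refl arg_cong2[where f="(<)"] arg_cong2[where f="(-)"] sum.cong) auto

text \<open>The partial sums take finitely many values up to time \<open>T\<close>, so strict positivity has a
  uniform margin.\<close>

lemma stays_above_margin:
  obtains \<delta> where "\<delta> > 0"
    "\<And>y i. stays_above p d y i \<Longrightarrow> 1 \<le> i \<Longrightarrow> i \<le> T \<Longrightarrow>
      real i * d + \<delta> \<le> (\<Sum>j<i. of_bool (y j)) - real i * p"
proof
  define V where "V = (\<lambda>(i, h). real h - real i * p - real i * d) ` ({..T} \<times> {..T}) \<inter> {0<..}"
  \<comment> \<open>Inserting 1 keeps the minimum meaningful when no positive value occurs.\<close>
  have fin: "finite (insert 1 V)" by (simp add: V_def)
  show "Min (insert 1 V) > 0" by (subst Min_gr_iff[OF fin]) (auto simp: V_def)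
  fix y i assume y: "stays_above p d y i" and i: "1 \<le> i" "i \<le> T"
  define h where "h = card {j \<in> {..<i}. y j}"
  have h: "(\<Sum>j<i. of_bool (y j)) = real h"
    by (simp add: h_def of_bool_def sum.If_cases Int_def)
  have "h \<le> card {..<i}" unfolding h_def by (rule card_mono) auto
  then have "h \<le> T" using i by simp
  moreover have "real h - real i * p - real i * d > 0"
    using y i h by (force simp: stays_above_def)
  ultimately have "real h - real i * p - real i * d \<in> insert 1 V"
    using i by (force simp: V_def)
  from Min_le[OF fin this] show "real i * d + Min (insert 1 V) \<le> (\<Sum>j<i. of_bool (y j)) - real i * p"
    using h by simp
qed

lemma arm_two_run:
  assumes "s \<ge> 1" "\<And>j. j < m \<Longrightarrow> A (s + j) \<omega> = 2"
  shows "pulls A 2 (s + m) \<omega> = pulls A 2 s \<omega> + m" "pulls A 1 (s + m) \<omega> = pulls A 1 s \<omega>"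
    "reward_sum A R 2 (s + m) \<omega> = reward_sum A R 2 s \<omega> + (\<Sum>j<m. of_bool (R (s + j) \<omega>))"
    "reward_sum A R 1 (s + m) \<omega> = reward_sum A R 1 s \<omega>"
  using assms(2)
proof (induction m)
  case (Suc m)
  { case 1 then show ?case using Suc assms(1) by (simp add: pulls_Suc) }
  { case 2 then show ?case using Suc assms(1) by (simp add: pulls_Suc) }
  { case 3 then show ?case using Suc assms(1) by (simp add: reward_sum_Suc) }
  { case 4 then show ?case using Suc assms(1) by (simp add: reward_sum_Suc) }
qed simp_all

text \<open>The choice at \<open>s + i\<close> sees exactly the rewards at
  \<open>s, ..., s + i - 1\<close>, and as long as these stay above,
  \<open>index_gap_positive\<close> keeps arm 2 strictly ahead. All offsets \<open>j \<le> i\<close>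
  are carried through the induction because the counts at the next time require an unbroken
  run.\<close>

lemma (in ucb_path) arm_two_persists:
  assumes margin: "\<And>y i. stays_above (\<mu> 2) ((\<mu> 1 - \<mu> 2) / 2) y i \<Longrightarrow> 1 \<le> i \<Longrightarrow> i \<le> T \<Longrightarrow>
      real i * ((\<mu> 1 - \<mu> 2) / 2) + \<delta> \<le> (\<Sum>j<i. of_bool (y j)) - real i * \<mu> 2"
    and \<epsilon>: "3 / 2 * real T * \<epsilon> < \<delta>"
    and good: "good_time \<mu> T \<epsilon> A R s \<omega>" and s: "s \<ge> 1" "A s \<omega> = 2"
    and above: "stays_above (\<mu> 2) ((\<mu> 1 - \<mu> 2) / 2) (\<lambda>j. R (s + j) \<omega>) i" and "i \<le> T" and "j \<le> i"
  shows "A (s + j) \<omega> = 2"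
  using above \<open>i \<le> T\<close> \<open>j \<le> i\<close>
proof (induction i arbitrary: j)
  case 0 then show ?case using s by simp
next
  case (Suc i)
  have run: "A (s + j) \<omega> = 2" if "j < Suc i" for j
    using Suc.IH[of j] stays_above_mono[OF Suc.prems(1)] Suc.prems(2) that by auto
  note R = arm_two_run[where m = "Suc i" and A = A and \<omega> = \<omega>, OF s(1) run]
  let ?n = "real (pulls A 2 s \<omega>)" and ?N = "real (pulls A 1 s \<omega>)"
  have n: "pulls A 2 s \<omega> \<ge> 1" and N: "pulls A 1 s \<omega> \<ge> pulls A 2 s \<omega> + T"
    using good by (auto simp: good_time_def)
  have sqrt_eq: "sqrt (2 * ln (real t) / k) = sqrt (2 * ln (real t)) / sqrt k" for t k
    by (simp add: real_sqrt_divide)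
  have "emp_mean A R 1 s \<omega> + sqrt (2 * ln (real (s + Suc i))) / sqrt ?N
     < (reward_sum A R 2 s \<omega> + (\<Sum>j<Suc i. of_bool (R (s + j) \<omega>))) / (?n + real (Suc i))
       + sqrt (2 * ln (real (s + Suc i))) / sqrt (?n + real (Suc i))"
  proof (rule index_gap_positive[where g = "sqrt (2 * ln (real s))" and T = "real T"
        and p = "\<mu> 2" and d = "(\<mu> 1 - \<mu> 2) / 2" and \<epsilon> = \<epsilon> and \<delta> = \<delta>])
    show "emp_mean A R 1 s \<omega> + sqrt (2 * ln (real s)) / sqrt ?N
      \<le> reward_sum A R 2 s \<omega> / ?n + sqrt (2 * ln (real s)) / sqrt ?n"
      using index_le(2)[of s 2 1] s n by (simp add: sqrt_eq emp_mean_eq)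
    show "real (Suc i) * ((\<mu> 1 - \<mu> 2) / 2) + \<delta> \<le> (\<Sum>j<Suc i. of_bool (R (s + j) \<omega>)) - real (Suc i) * \<mu> 2"
      by (rule margin[OF Suc.prems(1)]) (use Suc.prems(2) in auto)
    show "sqrt (2 * ln (real s)) / sqrt ?n * (1 + real T / ?n) \<le> 2 * ((\<mu> 1 - \<mu> 2) / 2) + \<epsilon>"
    proof -
      have e: "2 * ((\<mu> 1 - \<mu> 2) / 2) = \<mu> 1 - \<mu> 2" by simp
      show ?thesis unfolding e using good unfolding good_time_def sqrt_eq by blast
    qed
    show "\<bar>reward_sum A R 2 s \<omega> / ?n - \<mu> 2\<bar> \<le> \<epsilon>"
      using good by (simp add: good_time_def emp_mean_eq)
  qed (use n N s Suc.prems \<epsilon> in auto)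
  then have "A (s + Suc i) \<omega> = 2"
    by (intro arm_if_index_greater[of _ 1 2])
       (use R n N Suc.prems(2) s in \<open>auto simp: emp_mean_eq real_sqrt_divide ac_simps simp del: sum.lessThan_Suc\<close>)
  with run Suc.prems(3) show ?case by (cases "j = Suc i") auto
qed

section \<open>Exploration times\<close>

text \<open>Rewrites a hitting time as a condition on finitely many rounds, the form in which
  \<open>tau\<close> is later shown to be a stopping time.\<close>

lemma Inf_enat_Collect_eq: "Inf {enat t | t. P t} = enat s \<longleftrightarrow> P s \<and> (\<forall>r<s. \<not> P r)"
proof (cases "\<exists>t. P t")
  case True
  have "Inf {enat t | t. P t} = enat (LEAST t. P t)"
  proof (rule antisym)
    show "Inf {enat t | t. P t} \<le> enat (LEAST t. P t)"
      using LeastI_ex[OF True] by (auto intro: Inf_lower)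
    show "enat (LEAST t. P t) \<le> Inf {enat t | t. P t}"
      by (rule Inf_greatest) (auto intro: Least_le)
  qed
  moreover have "(LEAST t. P t) = s \<longleftrightarrow> P s \<and> (\<forall>r<s. \<not> P r)"
    using LeastI_ex[OF True] by (metis Least_equality not_less not_less_Least)
  ultimately show ?thesis by simp
next
  case False
  then have "{enat t | t. P t} = {}" by auto
  with False show ?thesis by (simp add: Inf_enat_def)
qed

lemma tau_one_eq:
  "tau A (Suc 0) \<omega> = enat s \<longleftrightarrow> s \<ge> 1 \<and> A s \<omega> = 2 \<and> (\<forall>r<s. r \<ge> 1 \<longrightarrow> A r \<omega> \<noteq> 2)"
  by (auto simp: Inf_enat_Collect_eq)

lemma tau_Suc_Suc_eq:
  "tau A (Suc (Suc k)) \<omega> = enat s \<longleftrightarrow>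
     (\<exists>r<s. tau A (Suc k) \<omega> = enat r \<and> A s \<omega> = 2 \<and> A (s - 1) \<omega> = 1 \<and>
        (\<forall>u<s. r < u \<longrightarrow> \<not> (A u \<omega> = 2 \<and> A (u - 1) \<omega> = 1)))"
  by (cases "tau A (Suc k) \<omega>") (auto simp: Inf_enat_Collect_eq top_enat_def simp del: tau.simps(2))

declare tau.simps(2,3) [simp del]

text \<open>Successive starts are distinct, so episode number bounds time from below; this turns
  large \<open>k\<close> into large \<open>s\<close>. The first episode may start at time 1, where
  there is no preceding arm, hence the condition \<open>k \<ge> 1\<close>.\<close>

lemma tau_SucD:
  assumes "tau A (Suc k) \<omega> = enat s"
  shows "s \<ge> Suc k" "A s \<omega> = 2" "k \<ge> 1 \<Longrightarrow> A (s - 1) \<omega> = 1"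
  using assms
proof (induction k arbitrary: s)
  case 0
  { case 1 then show ?case by (simp add: tau_one_eq) }
  { case 2 then show ?case by (simp add: tau_one_eq) }
  { case 3 then show ?case by simp }
next
  case (Suc k)
  { case 1 then show ?case using Suc.IH(1) by (fastforce simp: tau_Suc_Suc_eq) }
  { case 2 then show ?case by (auto simp: tau_Suc_Suc_eq) }
  { case 3 then show ?case by (auto simp: tau_Suc_Suc_eq) }
qed

context ucb_path
begin

lemma exists_switch: "\<exists>t>r. A t \<omega> = 2 \<and> A (t - 1) \<omega> = 1"
proof -
  obtain t1 where t1: "t1 \<ge> Suc r" "A t1 \<omega> = 1" using exists_pull[of 1 "Suc r"] by auto
  define t where "t = (LEAST t. t \<ge> t1 \<and> A t \<omega> = 2)"
  have t: "t \<ge> t1" "A t \<omega> = 2"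
    using LeastI_ex[of "\<lambda>t. t \<ge> t1 \<and> A t \<omega> = 2"] exists_pull[of 2 t1] by (auto simp: t_def)
  have "t > t1" using t t1 by (cases "t = t1") auto
  moreover have "\<not> (t - 1 \<ge> t1 \<and> A (t - 1) \<omega> = 2)"
    by (rule not_less_Least) (use \<open>t > t1\<close> in \<open>simp add: t_def[symmetric]\<close>)
  ultimately have "A (t - 1) \<omega> = 1" using arm_cases[of "t - 1"] t1 by auto
  then show ?thesis using t t1 by (intro exI[of _ t]) auto
qed

lemma tau_finite: "\<exists>s. tau A (Suc k) \<omega> = enat s"
proof (induction k)
  case 0
  have ex: "\<exists>t\<ge>1. A t \<omega> = 2" using exists_pull[of 2 1] by auto
  define s where "s = (LEAST t. t \<ge> 1 \<and> A t \<omega> = 2)"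
  have "s \<ge> 1 \<and> A s \<omega> = 2" using LeastI_ex[OF ex] unfolding s_def by blast
  moreover have "\<forall>r<s. r \<ge> 1 \<longrightarrow> A r \<omega> \<noteq> 2" unfolding s_def using not_less_Least by blast
  ultimately show ?case by (auto simp: tau_one_eq)
next
  case (Suc k)
  then obtain r where r: "tau A (Suc k) \<omega> = enat r" by blast
  let ?P = "\<lambda>t. t > r \<and> A t \<omega> = 2 \<and> A (t - 1) \<omega> = 1"
  define s where "s = (LEAST t. ?P t)"
  have "?P s" unfolding s_def by (rule LeastI_ex[OF exists_switch])
  moreover have "\<forall>u<s. \<not> ?P u" unfolding s_def using not_less_Least by blast
  ultimately show ?case using r by (auto simp: tau_Suc_Suc_eq)
qed

lemma eventually_good_tau:
  assumes conv: "\<And>a. a \<in> {1, 2} \<Longrightarrow> ((\<lambda>t. emp_mean A R a t \<omega>) \<longlongrightarrow> \<mu> a) at_top"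
    and gap: "\<mu> 2 < (\<mu> 1 :: real)" and \<epsilon>: "\<epsilon> > 0"
  shows "eventually (\<lambda>k. \<exists>s. tau A k \<omega> = enat s \<and> good_time \<mu> T \<epsilon> A R s \<omega>) at_top"
proof -
  obtain s0 where s0: "\<And>s. s \<ge> s0 \<Longrightarrow> A s \<omega> = 2 \<Longrightarrow> A (s - 1) \<omega> = 1 \<Longrightarrow> good_time \<mu> T \<epsilon> A R s \<omega>"
    using eventually_good_time[OF conv gap \<epsilon>, of T] by (auto simp: eventually_at_top_linorder)
  show ?thesis
    \<comment> \<open>With \<open>k = Suc l\<close>, this gives \<open>s \<ge> s0\<close> as well as
      \<open>l \<ge> 1\<close>, so that the start is preceded by a pull of arm 1.\<close>
    using eventually_ge_at_top[of "s0 + 2"]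
  proof eventually_elim
    case (elim k)
    then obtain l where l: "k = Suc l" "l \<ge> 1" by (cases k) auto
    obtain s where s: "tau A k \<omega> = enat s" using tau_finite[of l] l by auto
    note D = tau_SucD[OF s[unfolded l]]
    have "good_time \<mu> T \<epsilon> A R s \<omega>" by (rule s0) (use D l elim in auto)
    with s show ?case by blast
  qed
qed

end

section \<open>Measurability with respect to the past\<close>

context two_armed_bernoulli_bandit
begin

abbreviation "F \<equiv> past M MU U A R"

definition history :: "nat \<Rightarrow> 'w \<Rightarrow> 'u \<times> (nat \<Rightarrow> nat \<times> bool)" where
  "history t \<omega> = (U \<omega>, \<lambda>i\<in>{1..<t}. (A i \<omega>, R i \<omega>))"

definition history_space :: "nat \<Rightarrow> ('u \<times> (nat \<Rightarrow> nat \<times> bool)) measure" where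
  "history_space t = MU \<Otimes>\<^sub>M (\<Pi>\<^sub>M i\<in>{1..<t}. count_space {1, 2} \<Otimes>\<^sub>M count_space UNIV)"

lemma past_eq: "F t = vimage_algebra (space M) (history t) (history_space t)"
  unfolding past_def history_def[abs_def] history_space_def ..

lemma space_past [simp]: "space (F t) = space M"
  by (simp add: past_eq)

lemma arm_in: "t \<ge> 1 \<Longrightarrow> \<omega> \<in> space M \<Longrightarrow> A t \<omega> \<in> {1, 2}"
  using measurable_space[OF measurable_A, of t \<omega>] by simp

lemma measurable_historyI:
  assumes "U \<in> N \<rightarrow>\<^sub>M MU"
    and "\<And>i. 1 \<le> i \<Longrightarrow> i < t \<Longrightarrow> A i \<in> N \<rightarrow>\<^sub>M count_space {1, 2}"
    and "\<And>i. 1 \<le> i \<Longrightarrow> i < t \<Longrightarrow> R i \<in> N \<rightarrow>\<^sub>M count_space UNIV"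
  shows "history t \<in> N \<rightarrow>\<^sub>M history_space t"
  unfolding history_def[abs_def] history_space_def
  by (intro measurable_Pair measurable_restrict assms) auto

lemma history_measurable: "history t \<in> F t \<rightarrow>\<^sub>M history_space t"
  unfolding past_eq
proof (rule measurable_vimage_algebra1, rule funcsetI)
  fix \<omega> assume "\<omega> \<in> space M"
  then show "history t \<omega> \<in> space (history_space t)"
    using arm_in measurable_space[OF measurable_U]
    by (auto simp: history_def history_space_def space_pair_measure space_PiM)
qed

lemma measurable_U_past: "U \<in> F t \<rightarrow>\<^sub>M MU"
proof -
  have "(\<lambda>\<omega>. fst (history t \<omega>)) \<in> F t \<rightarrow>\<^sub>M MU"
    using history_measurable unfolding history_space_def by (rule measurable_fst')
  then show ?thesis by (simp add: history_def)
qed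

lemma measurable_past_component:
  assumes "1 \<le> i" "i < t"
  shows "(\<lambda>\<omega>. (A i \<omega>, R i \<omega>)) \<in> F t \<rightarrow>\<^sub>M count_space {1, 2} \<Otimes>\<^sub>M count_space UNIV"
proof -
  have "(\<lambda>\<omega>. snd (history t \<omega>) i) \<in> F t \<rightarrow>\<^sub>M count_space {1, 2} \<Otimes>\<^sub>M count_space UNIV"
    by (rule measurable_compose[OF measurable_snd'[OF history_measurable[unfolded history_space_def]]
          measurable_component_singleton]) (use assms in auto)
  then show ?thesis using assms by (simp add: history_def)
qed

lemma measurable_R_past: "1 \<le> i \<Longrightarrow> i < t \<Longrightarrow> R i \<in> F t \<rightarrow>\<^sub>M count_space UNIV"
  using measurable_snd'[OF measurable_past_component] by simp

lemma measurable_A_past_strict: "1 \<le> i \<Longrightarrow> i < t \<Longrightarrow> A i \<in> F t \<rightarrow>\<^sub>M count_space {1, 2}"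
  using measurable_fst'[OF measurable_past_component] by simp

lemma measurable_A_past:
  assumes "1 \<le> i" "i \<le> t"
  shows "A i \<in> F t \<rightarrow>\<^sub>M count_space UNIV"
proof -
  have "A i \<in> F t \<rightarrow>\<^sub>M count_space {1, 2}"
    using assms measurable_A measurable_A_past_strict by (cases "i = t") auto
  then show ?thesis by (rule measurable_compose) simp
qed

lemma past_mono: "s \<le> t \<Longrightarrow> sets (F s) \<subseteq> sets (F t)"
  unfolding past_eq[of s]
  by (intro sets_image_in_sets measurable_historyI measurable_U_past measurable_A_past_strict
      measurable_R_past) auto

text \<open>Arms are assumed measurable only with respect to the past, which in turn is generated by
  earlier arms; strong induction on time unwinds this mutual dependence.\<close>

lemma past_subset: "sets (F t) \<subseteq> sets M"
proof -
  have A_M: "A t \<in> M \<rightarrow>\<^sub>M count_space {1, 2}" if "t \<ge> 1" for t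
    using that
  proof (induction t rule: less_induct)
    case (less t)
    have "sets (F t) \<subseteq> sets M"
      unfolding past_eq
      by (intro sets_image_in_sets measurable_historyI measurable_U measurable_R) (use less in auto)
    then show ?case
      using measurable_A[OF less.prems] by (rule measurable_mono[OF order.refl refl _ space_past, THEN subsetD])
  qed
  show ?thesis
    unfolding past_eq
    by (intro sets_image_in_sets measurable_historyI measurable_U measurable_R A_M) auto
qed

lemma subalgebra_past: "subalgebra M (F t)"
  unfolding subalgebra_def using past_subset by simp

lemma measurable_A_M: "t \<ge> 1 \<Longrightarrow> A t \<in> M \<rightarrow>\<^sub>M count_space UNIV"
  using measurable_from_subalg[OF subalgebra_past measurable_A_past[OF _ order.refl]] .

section \<open>Statistics, exploration times and good times as objects of the filtration\<close>

lemma pulls_eq_sum: "real (pulls A a t \<omega>) = (\<Sum>i\<in>{1..<t}. of_bool (A i \<omega> = a))"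
  by (simp add: pulls_def of_bool_def sum.If_cases Int_def)

lemma reward_sum_eq_sum:
  "reward_sum A R a t \<omega> = (\<Sum>i\<in>{1..<t}. of_bool (A i \<omega> = a) * of_bool (R i \<omega>))"
  unfolding reward_sum_def sum.inter_filter[OF finite_atLeastLessThan] by (rule sum.cong) auto

lemma measurable_of_bool_A:
  assumes "1 \<le> i" "i \<le> t"
  shows "(\<lambda>\<omega>. of_bool (A i \<omega> = a) :: real) \<in> borel_measurable (F t)"
  by (rule measurable_compose[OF measurable_A_past[OF assms]]) simp

lemma measurable_of_bool_R:
  assumes "1 \<le> i" "i < t"
  shows "(\<lambda>\<omega>. of_bool (R i \<omega>) :: real) \<in> borel_measurable (F t)"
  by (rule measurable_compose[OF measurable_R_past[OF assms]]) simp

text \<open>The arm at \<open>t'\<close> is itself determined by the past of \<open>t'\<close>, so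
  counts may include that round; the reward sums below may not.\<close>

lemma measurable_pulls: "t \<le> Suc t' \<Longrightarrow> (\<lambda>\<omega>. real (pulls A a t \<omega>)) \<in> borel_measurable (F t')"
  unfolding pulls_eq_sum by (intro borel_measurable_sum measurable_of_bool_A) auto

lemma measurable_reward_sum: "t \<le> t' \<Longrightarrow> reward_sum A R a t \<in> borel_measurable (F t')"
  unfolding reward_sum_eq_sum[abs_def]
  by (intro borel_measurable_sum borel_measurable_times measurable_of_bool_A measurable_of_bool_R) auto

lemma measurable_emp_mean: "emp_mean A R a t \<in> borel_measurable (F t)"
  unfolding emp_mean_eq[abs_def]
  by (intro borel_measurable_divide measurable_reward_sum measurable_pulls) auto

lemma sets_A_eq: "1 \<le> i \<Longrightarrow> i \<le> t \<Longrightarrow> {\<omega> \<in> space M. A i \<omega> = a} \<in> sets (F t)"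
  using measurable_sets[OF measurable_A_past, of i t "{a}"] by (simp add: vimage_def Int_def conj_commute)

lemma sets_R_eq: "1 \<le> i \<Longrightarrow> i < t \<Longrightarrow> {\<omega> \<in> space M. R i \<omega> = b} \<in> sets (F t)"
  using measurable_sets[OF measurable_R_past, of i t "{b}"] by (simp add: vimage_def Int_def conj_commute)

text \<open>The stopping time property: the conditions on arms concern rounds up to
  \<open>s\<close>, and the arm at \<open>s\<close> is already known in \<open>F s\<close>.\<close>

lemma sets_tau_eq: "{\<omega> \<in> space M. tau A (Suc k) \<omega> = enat s} \<in> sets (F s)"
proof (induction k arbitrary: s)
  case 0
  have P: "Measurable.pred (F s) (\<lambda>\<omega>. A r \<omega> = 2)" if "1 \<le> r" "r \<le> s" for r
    using sets_A_eq[OF that, of 2] by (simp add: pred_def)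
  show ?case
  proof (cases "s \<ge> 1")
    case True
    have "Measurable.pred (F s) (\<lambda>\<omega>. A s \<omega> = 2 \<and> (\<forall>r\<in>{1..<s}. \<not> A r \<omega> = 2))"
      by (intro pred_intros_logic pred_intros_finite P) (use True in auto)
    also have "(\<lambda>\<omega>. A s \<omega> = 2 \<and> (\<forall>r\<in>{1..<s}. \<not> A r \<omega> = 2)) = (\<lambda>\<omega>. tau A (Suc 0) \<omega> = enat s)"
      using True by (auto simp: tau_one_eq fun_eq_iff)
    finally show ?thesis by (simp add: pred_def)
  qed (simp add: tau_one_eq)
next
  case (Suc k)
  have P: "Measurable.pred (F s) (\<lambda>\<omega>. A r \<omega> = a)" if "1 \<le> r" "r \<le> s" for r a
    using sets_A_eq[OF that, of a] by (simp add: pred_def)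
  have T: "Measurable.pred (F s) (\<lambda>\<omega>. tau A (Suc k) \<omega> = enat r)" if "r \<le> s" for r
    using Suc[of r] past_mono[OF that] by (auto simp: pred_def)
  have "Measurable.pred (F s) (\<lambda>\<omega>. \<exists>r\<in>{1..<s}. tau A (Suc k) \<omega> = enat r \<and> A s \<omega> = 2 \<and> A (s - 1) \<omega> = 1 \<and>
        (\<forall>u\<in>{r<..<s}. \<not> (A u \<omega> = 2 \<and> A (u - 1) \<omega> = 1)))"
    by (intro pred_intros_logic pred_intros_finite P T) auto
  also have "(\<lambda>\<omega>. \<exists>r\<in>{1..<s}. tau A (Suc k) \<omega> = enat r \<and> A s \<omega> = 2 \<and> A (s - 1) \<omega> = 1 \<and>
        (\<forall>u\<in>{r<..<s}. \<not> (A u \<omega> = 2 \<and> A (u - 1) \<omega> = 1))) = (\<lambda>\<omega>. tau A (Suc (Suc k)) \<omega> = enat s)"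
    unfolding tau_Suc_Suc_eq using tau_SucD(1)[of A k] by (fastforce simp: fun_eq_iff)
  finally show ?case by (simp add: pred_def)
qed

lemma sets_good_time: "{\<omega> \<in> space M. good_time \<mu>' T \<epsilon> A R s \<omega>} \<in> sets (F s)"
proof -
  note [measurable] = measurable_pulls[of s s] measurable_emp_mean
  have "good_time \<mu>' T \<epsilon> A R s \<omega> \<longleftrightarrow>
     real (pulls A 2 s \<omega>) \<ge> 1 \<and> real (pulls A 1 s \<omega>) \<ge> real (pulls A 2 s \<omega>) + real T \<and>
     \<bar>emp_mean A R 2 s \<omega> - \<mu>' 2\<bar> \<le> \<epsilon> \<and>
     sqrt (2 * ln (real s) / real (pulls A 2 s \<omega>)) * (1 + real T / real (pulls A 2 s \<omega>))
       \<le> \<mu>' 1 - \<mu>' 2 + \<epsilon>" for \<omega>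
    unfolding good_time_def by (simp flip: of_nat_add)
  moreover have "Measurable.pred (F s) (\<lambda>\<omega>.
     real (pulls A 2 s \<omega>) \<ge> 1 \<and> real (pulls A 1 s \<omega>) \<ge> real (pulls A 2 s \<omega>) + real T \<and>
     \<bar>emp_mean A R 2 s \<omega> - \<mu>' 2\<bar> \<le> \<epsilon> \<and>
     sqrt (2 * ln (real s) / real (pulls A 2 s \<omega>)) * (1 + real T / real (pulls A 2 s \<omega>))
       \<le> \<mu>' 1 - \<mu>' 2 + \<epsilon>)"
    by measurable
  ultimately show ?thesis by (simp add: pred_def)
qed

text \<open>The integrated form of the reward assumption. A test function supported on
  \<open>A t \<omega> = a\<close> replaces the random mean \<open>\<mu> (A t \<omega>)\<close> by a
  constant.\<close>

lemma integral_reward: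
  assumes t: "t \<ge> 1" and f: "f \<in> borel_measurable (F t)" and bound: "\<And>\<omega>. \<bar>f \<omega>\<bar> \<le> (B::real)"
    and arm: "\<And>\<omega>. \<omega> \<in> space M \<Longrightarrow> A t \<omega> \<noteq> a \<Longrightarrow> f \<omega> = 0"
  shows "(\<integral>\<omega>. f \<omega> * of_bool (R t \<omega>) \<partial>M) = \<mu> a * (\<integral>\<omega>. f \<omega> \<partial>M)"
proof -
  interpret finite_measure_subalgebra M "F t"
    by unfold_locales (rule subalgebra_past)
  have f_M [measurable]: "f \<in> borel_measurable M"
    using measurable_from_subalg[OF subalgebra_past f] .
  have R_M [measurable]: "(\<lambda>\<omega>. of_bool (R t \<omega>) :: real) \<in> borel_measurable M"
    by (rule measurable_compose[OF measurable_R[OF t]]) simp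
  have int: "integrable M (\<lambda>\<omega>. f \<omega> * of_bool (R t \<omega>))"
  proof (rule integrable_const_bound[where B = B])
    have "0 \<le> B" using order_trans[OF abs_ge_zero bound] .
    then show "AE \<omega> in M. norm (f \<omega> * of_bool (R t \<omega>)) \<le> B"
      using bound by (auto simp: of_bool_def)
  qed simp
  have "(\<integral>\<omega>. f \<omega> * of_bool (R t \<omega>) \<partial>M) =
      (\<integral>\<omega>. f \<omega> * real_cond_exp M (F t) (\<lambda>\<omega>. of_bool (R t \<omega>)) \<omega> \<partial>M)"
    by (rule real_cond_exp_intg(2)[symmetric, OF int f R_M])
  also have "\<dots> = (\<integral>\<omega>. \<mu> a * f \<omega> \<partial>M)"
  proof (rule integral_cong_AE)
    show "AE \<omega> in M. f \<omega> * real_cond_exp M (F t) (\<lambda>\<omega>. of_bool (R t \<omega>)) \<omega> = \<mu> a * f \<omega>"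
      using reward_bernoulli[OF t] AE_space
    proof eventually_elim
      case (elim \<omega>)
      then show ?case using arm[of \<omega>] by (cases "A t \<omega> = a") auto
    qed
  qed simp_all
  finally show ?thesis by simp
qed

lemma prob_reward:
  assumes t: "t \<ge> 1" and E: "E \<in> sets (F t)" and arm: "\<And>\<omega>. \<omega> \<in> E \<Longrightarrow> A t \<omega> = a"
  shows "prob (E \<inter> {\<omega> \<in> space M. R t \<omega> = b}) = (if b then \<mu> a else 1 - \<mu> a) * prob E"
proof -
  have E_M [measurable]: "E \<in> sets M" using E past_subset by auto
  have R_M: "{\<omega> \<in> space M. R t \<omega> = b} \<in> sets M" for b
    using sets_R_eq[of t "Suc t" b] t past_subset by auto
  have 1: "prob (E \<inter> {\<omega> \<in> space M. R t \<omega> = True}) = \<mu> a * prob E"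
  proof -
    have "(\<integral>\<omega>. (indicator E \<omega> :: real) * of_bool (R t \<omega>) \<partial>M) = \<mu> a * (\<integral>\<omega>. indicator E \<omega> \<partial>M)"
      by (rule integral_reward[OF t, where B = 1]) (use E arm in \<open>auto simp: indicator_def\<close>)
    also have "(\<integral>\<omega>. (indicator E \<omega> :: real) * of_bool (R t \<omega>) \<partial>M)
        = (\<integral>\<omega>. indicator (E \<inter> {\<omega> \<in> space M. R t \<omega> = True}) \<omega> \<partial>M)"
      by (intro Bochner_Integration.integral_cong) (auto simp: indicator_def)
    finally show ?thesis using R_M[of True] by simp
  qed
  show ?thesis
  proof (cases b)
    case False
    have "E \<inter> {\<omega> \<in> space M. R t \<omega> = False} = E - E \<inter> {\<omega> \<in> space M. R t \<omega> = True}"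
      using sets.sets_into_space[OF E_M] by auto
    then have "prob (E \<inter> {\<omega> \<in> space M. R t \<omega> = False}) = prob E - prob (E \<inter> {\<omega> \<in> space M. R t \<omega> = True})"
      using R_M[of True] by (simp add: finite_measure_Diff)
    with 1 False show ?thesis by (simp add: algebra_simps)
  qed (use 1 in simp)
qed

end

section \<open>A strong law for adaptively sampled rewards\<close>

text \<open>Hoeffding's lemma for a centred Bernoulli variable; negative \<open>l\<close> reduces to
  positive \<open>l\<close> by exchanging success and failure.\<close>

lemma bernoulli_mgf_le:
  fixes p l :: real
  assumes "0 \<le> p" "p \<le> 1"
  shows "p * exp (l * (1 - p)) + (1 - p) * exp (- (l * p)) \<le> exp (l\<^sup>2 / 8)"
proof -
  have pos: "q * exp (h * (1 - q)) + (1 - q) * exp (- (h * q)) \<le> exp (h\<^sup>2 / 8)"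
    if "0 \<le> q" "q \<le> 1" "h \<ge> 0" for q h :: real
  proof -
    have "q * (exp h - 1) \<ge> 0" using that by simp
    then have "1 + q * (exp h - 1) > 0" by linarith
    then have "exp (- h * q + ln (1 + q * (exp h - 1))) = exp (- h * q) * (1 + q * (exp h - 1))"
      by (simp only: exp_add exp_ln)
    also have "\<dots> = q * exp (h * (1 - q)) + (1 - q) * exp (- (h * q))"
      by (simp add: algebra_simps exp_add exp_diff exp_minus divide_inverse)
    finally have "q * exp (h * (1 - q)) + (1 - q) * exp (- (h * q)) = exp (- h * q + ln (1 + q * (exp h - 1)))" ..
    also have "\<dots> \<le> exp (h\<^sup>2 / 8)"
      unfolding exp_le_cancel_iff by (rule Hoeffdings_lemma_aux) (use that in auto)
    finally show ?thesis .
  qed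
  show ?thesis
  proof (cases "l \<ge> 0")
    case False
    then show ?thesis using pos[of "1 - p" "- l"] assms by (simp add: algebra_simps)
  qed (use pos assms in auto)
qed

context two_armed_bernoulli_bandit
begin

text \<open>Freezing the exponential supermartingale after \<open>n\<close> pulls turns a deviation at the random
  time of the \<open>n\<close>-th pull into a Markov bound at any single later time.\<close>

definition exp_mart :: "real \<Rightarrow> nat \<Rightarrow> nat \<Rightarrow> nat \<Rightarrow> 'w \<Rightarrow> real" where
  "exp_mart l a n t \<omega> = (\<Prod>i\<in>{1..<t}.
     if A i \<omega> = a \<and> pulls A a i \<omega> < n then exp (l * (of_bool (R i \<omega>) - \<mu> a) - l\<^sup>2 / 8) else 1)"

lemma exp_mart_Suc: "t \<ge> 1 \<Longrightarrow> exp_mart l a n (Suc t) \<omega> = exp_mart l a n t \<omega> *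
    (if A t \<omega> = a \<and> pulls A a t \<omega> < n then exp (l * (of_bool (R t \<omega>) - \<mu> a) - l\<^sup>2 / 8) else 1)"
  by (simp add: exp_mart_def)

lemma exp_mart_nonneg: "0 \<le> exp_mart l a n t \<omega>"
  unfolding exp_mart_def by (intro prod_nonneg) auto

lemma exp_mart_bound:
  assumes "0 \<le> \<mu> a" "\<mu> a \<le> 1"
  shows "\<bar>exp_mart l a n t \<omega>\<bar> \<le> exp \<bar>l\<bar> ^ (t - 1)"
proof -
  have "exp_mart l a n t \<omega> \<le> (\<Prod>i\<in>{1..<t}. exp \<bar>l\<bar>)"
    unfolding exp_mart_def
  proof (intro prod_mono conjI)
    fix i
    have "l * (of_bool (R i \<omega>) - \<mu> a) \<le> \<bar>l * (of_bool (R i \<omega>) - \<mu> a)\<bar>" by simp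
    also have "\<dots> \<le> \<bar>l\<bar> * 1" unfolding abs_mult using assms by (intro mult_left_mono) auto
    finally have "l * (of_bool (R i \<omega>) - \<mu> a) - l\<^sup>2 / 8 \<le> \<bar>l\<bar>"
      using zero_le_power2[of l] by linarith
    then show "(if A i \<omega> = a \<and> pulls A a i \<omega> < n then exp (l * (of_bool (R i \<omega>) - \<mu> a) - l\<^sup>2 / 8) else 1)
        \<le> exp \<bar>l\<bar>" by simp
  qed simp
  then show ?thesis using exp_mart_nonneg by simp
qed

lemma measurable_pull_below:
  assumes "1 \<le> i" "i \<le> t"
  shows "Measurable.pred (F t) (\<lambda>\<omega>. A i \<omega> = a \<and> pulls A a i \<omega> < n)"
proof -
  note [measurable] = measurable_pulls[OF le_SucI[OF assms(2)]]
  have [measurable]: "Measurable.pred (F t) (\<lambda>\<omega>. A i \<omega> = a)"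
    using sets_A_eq[OF assms, of a] by (simp add: pred_def)
  have "Measurable.pred (F t) (\<lambda>\<omega>. A i \<omega> = a \<and> real (pulls A a i \<omega>) < real n)"
    by measurable
  then show ?thesis by simp
qed

lemma measurable_exp_mart: "exp_mart l a n t \<in> borel_measurable (F t)"
  unfolding exp_mart_def[abs_def]
proof (intro borel_measurable_prod)
  fix i assume "i \<in> {1..<t}"
  then have i: "1 \<le> i" "i < t" "i \<le> t" by auto
  note [measurable] = measurable_of_bool_R[OF i(1,2)] measurable_pull_below[OF i(1,3), of a n]
  show "(\<lambda>\<omega>. if A i \<omega> = a \<and> pulls A a i \<omega> < n then exp (l * (of_bool (R i \<omega>) - \<mu> a) - l\<^sup>2 / 8) else 1)
      \<in> borel_measurable (F t)"
    by measurable
qed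

lemma integrable_exp_mart:
  assumes "0 \<le> \<mu> a" "\<mu> a \<le> 1"
  shows "integrable M (exp_mart l a n t)"
  by (rule integrable_const_bound[where B = "exp \<bar>l\<bar> ^ (t - 1)"])
     (use exp_mart_bound[OF assms] measurable_from_subalg[OF subalgebra_past measurable_exp_mart] in auto)

lemma integral_exp_mart_le_one:
  assumes \<mu>: "0 \<le> \<mu> a" "\<mu> a \<le> 1"
  shows "(\<integral>\<omega>. exp_mart l a n t \<omega> \<partial>M) \<le> 1"
proof (induction t)
  case 0
  show ?case by (simp add: exp_mart_def prob_space)
next
  case (Suc t)
  show ?case
  proof (cases "t \<ge> 1")
    case False
    then show ?thesis by (simp add: exp_mart_def prob_space)
  next
    case t: True
    define f where "f = (\<lambda>\<omega>. if A t \<omega> = a \<and> pulls A a t \<omega> < n then exp_mart l a n t \<omega> else 0)"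
    define c0 where "c0 = exp (- (l * \<mu> a) - l\<^sup>2 / 8)"
    define c1 where "c1 = exp (l * (1 - \<mu> a) - l\<^sup>2 / 8)"
    have f_F: "f \<in> borel_measurable (F t)"
    proof -
      note [measurable] = measurable_exp_mart measurable_pull_below[OF t order.refl, of a n]
      show ?thesis unfolding f_def by measurable
    qed
    have f_bound: "\<bar>f \<omega>\<bar> \<le> exp \<bar>l\<bar> ^ (t - 1)" for \<omega>
      using exp_mart_bound[OF \<mu>, of l n t \<omega>] by (auto simp: f_def)
    have f_M [measurable]: "f \<in> borel_measurable M"
      using measurable_from_subalg[OF subalgebra_past f_F] .
    have R_M [measurable]: "(\<lambda>\<omega>. of_bool (R t \<omega>) :: real) \<in> borel_measurable M"
      by (rule measurable_compose[OF measurable_R[OF t]]) simp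
    have int_f: "integrable M f"
      by (rule integrable_const_bound[where B = "exp \<bar>l\<bar> ^ (t - 1)"]) (use f_bound in auto)
    have int_fR: "integrable M (\<lambda>\<omega>. f \<omega> * of_bool (R t \<omega>))"
    proof (rule Bochner_Integration.integrable_bound[OF int_f])
      show "AE \<omega> in M. norm (f \<omega> * of_bool (R t \<omega>)) \<le> norm (f \<omega>)"
        by (auto simp: of_bool_def)
    qed simp
    have fR: "(\<integral>\<omega>. f \<omega> * of_bool (R t \<omega>) \<partial>M) = \<mu> a * (\<integral>\<omega>. f \<omega> \<partial>M)"
      by (rule integral_reward[OF t f_F f_bound]) (simp add: f_def)
    \<comment> \<open>A binary reward makes the new factor affine in the reward, so its expectation
      reduces to \<open>integral_reward\<close>.\<close>
    have "exp_mart l a n (Suc t) \<omega> =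
        exp_mart l a n t \<omega> + (c0 - 1) * f \<omega> + (c1 - c0) * (f \<omega> * of_bool (R t \<omega>))" for \<omega>
      by (auto simp: exp_mart_Suc[OF t] f_def c0_def c1_def algebra_simps)
    then have "(\<integral>\<omega>. exp_mart l a n (Suc t) \<omega> \<partial>M) =
        (\<integral>\<omega>. exp_mart l a n t \<omega> \<partial>M) + (c0 - 1) * (\<integral>\<omega>. f \<omega> \<partial>M) + (c1 - c0) * (\<mu> a * (\<integral>\<omega>. f \<omega> \<partial>M))"
      using integrable_exp_mart[OF \<mu>, of l n t] int_f int_fR by (simp add: fR)
    also have "\<dots> = (\<integral>\<omega>. exp_mart l a n t \<omega> \<partial>M) + (\<mu> a * c1 + (1 - \<mu> a) * c0 - 1) * (\<integral>\<omega>. f \<omega> \<partial>M)"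
      by (simp add: algebra_simps)
    also have "(\<mu> a * c1 + (1 - \<mu> a) * c0 - 1) * (\<integral>\<omega>. f \<omega> \<partial>M) \<le> 0"
    proof (rule mult_nonpos_nonneg)
      have "\<mu> a * c1 + (1 - \<mu> a) * c0 =
          (\<mu> a * exp (l * (1 - \<mu> a)) + (1 - \<mu> a) * exp (- (l * \<mu> a))) / exp (l\<^sup>2 / 8)"
        by (simp add: c0_def c1_def exp_diff add_divide_distrib)
      also have "\<dots> \<le> 1" using bernoulli_mgf_le[OF \<mu>, of l] by simp
      finally show "\<mu> a * c1 + (1 - \<mu> a) * c0 - 1 \<le> 0" by simp
      show "0 \<le> (\<integral>\<omega>. f \<omega> \<partial>M)" by (rule Bochner_Integration.integral_nonneg) (simp add: f_def exp_mart_nonneg)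
    qed
    finally show ?thesis using Suc by simp
  qed
qed

lemma exp_mart_eq:
  "pulls A a t \<omega> \<le> n \<Longrightarrow> exp_mart l a n t \<omega> =
     exp (l * (reward_sum A R a t \<omega> - \<mu> a * pulls A a t \<omega>) - l\<^sup>2 / 8 * pulls A a t \<omega>)"
proof (induction t)
  case (Suc t)
  show ?case
  proof (cases "t \<ge> 1")
    case True
    then show ?thesis using Suc
      by (auto simp: exp_mart_Suc pulls_Suc reward_sum_Suc exp_add[symmetric] algebra_simps)
  qed (simp add: exp_mart_def reward_sum_def)
qed (simp add: exp_mart_def reward_sum_def)

lemma exp_mart_frozen:
  assumes "pulls A a t \<omega> \<ge> n" "1 \<le> t" "t \<le> t'"
  shows "exp_mart l a n t' \<omega> = exp_mart l a n t \<omega>"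
  using assms(3)
proof (induction t' rule: dec_induct)
  case (step t')
  then show ?case using assms pulls_mono[of t t' A a \<omega>] by (simp add: exp_mart_Suc)
qed simp

lemma prob_deviation_le:
  fixes l x :: real and n :: nat
  assumes \<mu>: "0 \<le> \<mu> a" "\<mu> a \<le> 1"
  defines "D \<equiv> {\<omega> \<in> space M. \<exists>t\<ge>1. pulls A a t \<omega> = n \<and> x \<le> l * (reward_sum A R a t \<omega> - \<mu> a * n)}"
  shows "D \<in> sets M" "prob D \<le> exp (l\<^sup>2 / 8 * n - x)"
proof -
  define B where "B = (\<lambda>m. {\<omega> \<in> space M. \<exists>t\<in>{1..m}. pulls A a t \<omega> = n \<and>
    x \<le> l * (reward_sum A R a t \<omega> - \<mu> a * n)})"
  have B_sets: "B m \<in> sets M" for m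
  proof -
    have [measurable]: "(\<lambda>\<omega>. real (pulls A a t \<omega>)) \<in> borel_measurable M"
      "reward_sum A R a t \<in> borel_measurable M" for t
      using measurable_from_subalg[OF subalgebra_past measurable_pulls[of t t]]
        measurable_from_subalg[OF subalgebra_past measurable_reward_sum[of t t]] by auto
    have "Measurable.pred M (\<lambda>\<omega>. \<exists>t\<in>{1..m}. real (pulls A a t \<omega>) = real n \<and>
        x \<le> l * (reward_sum A R a t \<omega> - \<mu> a * n))"
      by measurable
    then show ?thesis by (simp add: B_def pred_def)
  qed
  have D_eq: "D = (\<Union>m. B m)" by (force simp: D_def B_def)
  then show "D \<in> sets M" using B_sets by auto
  have "incseq B" by (force simp: incseq_def B_def)
  then have "(\<lambda>m. prob (B m)) \<longlonglongrightarrow> prob D"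
    unfolding D_eq using B_sets by (intro finite_Lim_measure_incseq) auto
  moreover have "prob (B m) \<le> exp (l\<^sup>2 / 8 * n - x)" for m
  proof -
    let ?c = "exp (x - l\<^sup>2 / 8 * n)"
    have "B m \<subseteq> {\<omega> \<in> space M. exp_mart l a n m \<omega> \<ge> ?c}"
    proof
      fix \<omega> assume "\<omega> \<in> B m"
      then obtain t where t: "\<omega> \<in> space M" "1 \<le> t" "t \<le> m" "pulls A a t \<omega> = n"
        "x \<le> l * (reward_sum A R a t \<omega> - \<mu> a * n)" by (auto simp: B_def)
      have "exp_mart l a n m \<omega> = exp_mart l a n t \<omega>" by (rule exp_mart_frozen) (use t in auto)
      with t show "\<omega> \<in> {\<omega> \<in> space M. exp_mart l a n m \<omega> \<ge> ?c}" by (simp add: exp_mart_eq)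
    qed
    moreover have "{\<omega> \<in> space M. exp_mart l a n m \<omega> \<ge> ?c} \<in> sets M"
      using measurable_from_subalg[OF subalgebra_past measurable_exp_mart[of l a n m]] by measurable
    ultimately have "prob (B m) \<le> prob {\<omega> \<in> space M. exp_mart l a n m \<omega> \<ge> ?c}"
      by (rule finite_measure_mono)
    also have "\<dots> \<le> (\<integral>\<omega>. exp_mart l a n m \<omega> \<partial>M) / ?c"
      by (rule integral_Markov_inequality_measure[where A = "{}"])
         (use integrable_exp_mart[OF \<mu>] exp_mart_nonneg in auto)
    also have "\<dots> \<le> 1 / ?c"
      using integral_exp_mart_le_one[OF \<mu>] by (intro divide_right_mono) auto
    finally show ?thesis by (simp add: exp_diff)
  qed
  ultimately show "prob D \<le> exp (l\<^sup>2 / 8 * n - x)" by (intro LIMSEQ_le_const2) auto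
qed

text \<open>The choice \<open>4 * \<epsilon>\<close> minimises
  \<open>l\<^sup>2 / 8 - l * \<epsilon>\<close> over \<open>l \<ge> 0\<close>, leaving
  \<open>- 2 * \<epsilon>\<^sup>2\<close> per pull. Borel-Cantelli runs over pull counts; the two
  signs of \<open>l\<close> give the two tails.\<close>

lemma AE_deviation_eventually:
  fixes l \<epsilon> :: real
  assumes \<mu>: "0 \<le> \<mu> a" "\<mu> a \<le> 1" and \<epsilon>: "\<epsilon> > 0" and l: "\<bar>l\<bar> = 4 * \<epsilon>"
  shows "AE \<omega> in M. eventually (\<lambda>n. \<forall>t\<ge>1. pulls A a t \<omega> = n \<longrightarrow>
      l * (reward_sum A R a t \<omega> - \<mu> a * real n) < 4 * \<epsilon>\<^sup>2 * real n) sequentially"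
proof -
  define D where "D = (\<lambda>n. {\<omega> \<in> space M. \<exists>t\<ge>1. pulls A a t \<omega> = n \<and>
    4 * \<epsilon>\<^sup>2 * real n \<le> l * (reward_sum A R a t \<omega> - \<mu> a * real n)})"
  have "l\<^sup>2 = 16 * \<epsilon>\<^sup>2"
    by (simp only: power2_abs[of l, symmetric] l) (simp add: power_mult_distrib)
  then have l2: "l\<^sup>2 / 8 * real n - 4 * \<epsilon>\<^sup>2 * real n = real n * (- 2 * \<epsilon>\<^sup>2)" for n
    by simp
  have D: "D n \<in> sets M" for n
    unfolding D_def by (rule prob_deviation_le(1)[OF \<mu>])
  have prob_D: "prob (D n) \<le> exp (- 2 * \<epsilon>\<^sup>2) ^ n" for n
    using prob_deviation_le(2)[OF \<mu>, of n "4 * \<epsilon>\<^sup>2 * real n" l]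
    unfolding D_def l2 exp_of_nat_mult .
  have "summable (\<lambda>n. exp (- 2 * \<epsilon>\<^sup>2) ^ n)" using \<epsilon> by (intro summable_geometric) simp
  then have "summable (\<lambda>n. prob (D n))"
    by (rule summable_comparison_test'[where N = 0]) (use prob_D in simp)
  then have "AE \<omega> in M. eventually (\<lambda>n. \<omega> \<in> space M - D n) sequentially"
    using D by (intro borel_cantelli_AE1) (auto simp: emeasure_eq_measure)
  then show ?thesis
  proof eventually_elim
    case (elim \<omega>)
    then show ?case by eventually_elim (auto simp: D_def not_le)
  qed
qed

lemma ucb_path_if_follows_UCB:
  "follows_UCB M A R \<Longrightarrow> \<omega> \<in> space M \<Longrightarrow> ucb_path A R \<omega>"
  by (simp add: follows_UCB_def ucb_path_def)

text \<open>Countably many accuracies \<open>1 / (k + 1)\<close> share one null set. The UCB rule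
  enters because it makes the pull counts tend to infinity.\<close>

lemma AE_emp_mean_tendsto:
  assumes ucb: "follows_UCB M A R" and a: "a \<in> {1, 2}" and \<mu>: "0 \<le> \<mu> a" "\<mu> a \<le> 1"
  shows "AE \<omega> in M. (\<lambda>t. emp_mean A R a t \<omega>) \<longlonglongrightarrow> \<mu> a"
proof -
  define \<epsilon> where "\<epsilon> = (\<lambda>k. 1 / (real k + 1))"
  have \<epsilon>: "\<epsilon> k > 0" for k by (simp add: \<epsilon>_def)
  have "AE \<omega> in M. \<forall>k. eventually (\<lambda>n. \<forall>t\<ge>1. pulls A a t \<omega> = n \<longrightarrow>
      (4 * \<epsilon> k) * (reward_sum A R a t \<omega> - \<mu> a * real n) < 4 * (\<epsilon> k)\<^sup>2 * real n) sequentially"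
    unfolding AE_all_countable using \<epsilon> by (intro allI AE_deviation_eventually \<mu>) (auto simp: less_imp_le)
  moreover have "AE \<omega> in M. \<forall>k. eventually (\<lambda>n. \<forall>t\<ge>1. pulls A a t \<omega> = n \<longrightarrow>
      (- 4 * \<epsilon> k) * (reward_sum A R a t \<omega> - \<mu> a * real n) < 4 * (\<epsilon> k)\<^sup>2 * real n) sequentially"
    unfolding AE_all_countable using \<epsilon> by (intro allI AE_deviation_eventually \<mu>) (auto simp: abs_mult less_imp_le)
  ultimately show ?thesis
    using AE_space
  proof eventually_elim
    case (elim \<omega>)
    interpret ucb_path A R \<omega> by (rule ucb_path_if_follows_UCB[OF ucb elim(3)])
    show ?case
    proof (rule LIMSEQ_I)
      fix r :: real assume "r > 0"
      then obtain k where k: "\<epsilon> k < r" unfolding \<epsilon>_def using reals_Archimedean[of r]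
        by (auto simp: inverse_eq_divide add.commute)
      have "eventually (\<lambda>n. \<forall>t\<ge>1. pulls A a t \<omega> = n \<longrightarrow> \<bar>emp_mean A R a t \<omega> - \<mu> a\<bar> < \<epsilon> k) sequentially"
        using elim(1)[rule_format, of k] elim(2)[rule_format, of k] eventually_gt_at_top[of 0]
      proof eventually_elim
        case (elim n)
        show ?case
        proof (intro allI impI)
          fix t :: nat assume t: "t \<ge> 1" "pulls A a t \<omega> = n"
          let ?d = "reward_sum A R a t \<omega> - \<mu> a * real n"
          have "\<epsilon> k * (4 * ?d) < \<epsilon> k * (4 * \<epsilon> k * real n)" "\<epsilon> k * (4 * - ?d) < \<epsilon> k * (4 * \<epsilon> k * real n)"
            using elim(1,2) t by (auto simp: power2_eq_square algebra_simps)
          moreover have "\<bar>d\<bar> < e * r" if "e * (4 * d) < e * (4 * e * r)" "e * (4 * - d) < e * (4 * e * r)" "e > 0"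
            for d e r :: real
            using that unfolding mult_less_cancel_left_pos[OF that(3)] by (simp add: abs_less_iff)
          ultimately have "\<bar>?d\<bar> < \<epsilon> k * real n" using \<epsilon> by blast
          moreover have "emp_mean A R a t \<omega> - \<mu> a = ?d / real n"
            using elim(3) t by (simp add: emp_mean_eq diff_divide_distrib)
          ultimately show "\<bar>emp_mean A R a t \<omega> - \<mu> a\<bar> < \<epsilon> k"
            using elim(3) by (simp add: divide_less_eq)
        qed
      qed
      \<comment> \<open>Passage from large counts to large times; afterwards \<open>t' = t\<close>
        is taken.\<close>
      then have "eventually (\<lambda>t. \<forall>t'\<ge>1. pulls A a t' \<omega> = pulls A a t \<omega> \<longrightarrow> \<bar>emp_mean A R a t' \<omega> - \<mu> a\<bar> < \<epsilon> k) sequentially"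
        by (rule eventually_compose_filterlim[OF _ filterlim_pulls[OF a]])
      then have "eventually (\<lambda>t. \<bar>emp_mean A R a t \<omega> - \<mu> a\<bar> < r) sequentially"
        using eventually_ge_at_top[of 1] by eventually_elim (use k in force)
      then show "\<exists>no. \<forall>n\<ge>no. norm (emp_mean A R a n \<omega> - \<mu> a) < r"
        by (simp add: eventually_sequentially)
    qed
  qed
qed

end

section \<open>Expected regret of exploration\<close>

definition pattern_weight :: "real \<Rightarrow> (nat \<Rightarrow> bool) \<Rightarrow> nat \<Rightarrow> real" where
  "pattern_weight p y i = (\<Prod>j<i. if y j then p else 1 - p)"

text \<open>Patterns are extensional on \<open>{..<i}\<close>, which makes the set finite and
  distinct patterns incompatible.\<close>

definition above_patterns :: "real \<Rightarrow> real \<Rightarrow> nat \<Rightarrow> (nat \<Rightarrow> bool) set" where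
  "above_patterns p d i = {y \<in> {..<i} \<rightarrow>\<^sub>E UNIV. stays_above p d y i}"

lemma finite_above_patterns: "finite (above_patterns p d i)"
  unfolding above_patterns_def by (rule finite_subset[OF _ finite_PiE[of "{..<i}" "\<lambda>_. UNIV"]]) auto

text \<open>Serves both sides of the comparison: the i.i.d. sequence with \<open>H\<close> the whole
  space, and the rewards of an episode with \<open>H\<close> a good start.\<close>

lemma (in finite_measure) measure_stays_above:
  assumes sets: "\<And>y. {\<omega> \<in> H. \<forall>j<i. Y j \<omega> = y j} \<in> sets M"
  shows "{\<omega> \<in> H. stays_above p d (\<lambda>j. Y j \<omega>) i} \<in> sets M"
    and "measure M {\<omega> \<in> H. stays_above p d (\<lambda>j. Y j \<omega>) i} =
      (\<Sum>y\<in>above_patterns p d i. measure M {\<omega> \<in> H. \<forall>j<i. Y j \<omega> = y j})"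
proof -
  have eq: "{\<omega> \<in> H. stays_above p d (\<lambda>j. Y j \<omega>) i} =
      (\<Union>y\<in>above_patterns p d i. {\<omega> \<in> H. \<forall>j<i. Y j \<omega> = y j})" (is "?L = ?R")
  proof (intro equalityI subsetI)
    fix \<omega> assume \<omega>: "\<omega> \<in> ?L"
    let ?y = "restrict (\<lambda>j. Y j \<omega>) {..<i}"
    have "stays_above p d ?y i \<longleftrightarrow> stays_above p d (\<lambda>j. Y j \<omega>) i" by (rule stays_above_cong) simp
    with \<omega> have "?y \<in> above_patterns p d i" by (simp add: above_patterns_def)
    with \<omega> show "\<omega> \<in> ?R" by (intro UN_I[of ?y]) auto
  next
    fix \<omega> assume "\<omega> \<in> ?R"
    then obtain y where y: "stays_above p d y i" "\<omega> \<in> H" "\<And>j. j < i \<Longrightarrow> Y j \<omega> = y j"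
      by (auto simp: above_patterns_def)
    have "stays_above p d y i \<longleftrightarrow> stays_above p d (\<lambda>j. Y j \<omega>) i"
      by (rule stays_above_cong) (simp add: y)
    with y show "\<omega> \<in> ?L" by simp
  qed
  show "?L \<in> sets M" unfolding eq by (intro sets.finite_UN finite_above_patterns sets)
  show "measure M ?L = (\<Sum>y\<in>above_patterns p d i. measure M {\<omega> \<in> H. \<forall>j<i. Y j \<omega> = y j})"
    unfolding eq
  proof (rule finite_measure_finite_Union[OF finite_above_patterns])
    show "disjoint_family_on (\<lambda>y. {\<omega> \<in> H. \<forall>j<i. Y j \<omega> = y j}) (above_patterns p d i)"
      unfolding disjoint_family_on_def
    proof (intro ballI impI)
      fix y z assume yz: "y \<in> above_patterns p d i" "z \<in> above_patterns p d i" "y \<noteq> z"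
      have "\<exists>j<i. y j \<noteq> z j"
      proof (rule ccontr)
        assume "\<not> (\<exists>j<i. y j \<noteq> z j)"
        then have "y = z"
          using yz(1,2) unfolding above_patterns_def by (intro PiE_ext[of y "{..<i}" "\<lambda>_. UNIV" z]) auto
        with yz(3) show False by simp
      qed
      then show "{\<omega> \<in> H. \<forall>j<i. Y j \<omega> = y j} \<inter> {\<omega> \<in> H. \<forall>j<i. Y j \<omega> = z j} = {}" by auto
    qed
    show "(\<lambda>y. {\<omega> \<in> H. \<forall>j<i. Y j \<omega> = y j}) ` above_patterns p d i \<subseteq> sets M"
      by (rule image_subsetI) (rule sets)
  qed
qed

text \<open>The tail-sum formula: a number at most \<open>T\<close> is the sum over
  \<open>i < T\<close> of the indicators that it exceeds \<open>i\<close>.\<close>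

lemma real_sigma_stop_eq:
  "real (sigma_stop \<mu> X T \<omega>) =
     (\<Sum>i<T. of_bool (stays_above (\<mu> 2) ((\<mu> 1 - \<mu> 2) / 2) (\<lambda>j. X (Suc j) \<omega>) i))"
proof -
  let ?d = "(\<mu> 1 - \<mu> 2) / 2"
  define C where "C t \<longleftrightarrow> - ?d + (1 / real t) * (\<Sum>i = 1..t. of_bool (X i \<omega>) - \<mu> 2) \<le> 0" for t
  define S where "S = Inf {enat t | t. t \<ge> 1 \<and> C t}"
  have C: "C t \<longleftrightarrow> \<not> real t * ?d < (\<Sum>j<t. of_bool (X (Suc j) \<omega>)) - real t * \<mu> 2" if "t \<ge> 1" for t
  proof -
    have "(\<Sum>i = 1..t. of_bool (X i \<omega>) - \<mu> 2) = (\<Sum>j<t. of_bool (X (Suc j) \<omega>)) - real t * \<mu> 2"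
      by (simp add: sum_subtractf sum.atLeast1_atMost_eq del: sum_of_bool_eq)
    then have "C t \<longleftrightarrow> ((\<Sum>j<t. of_bool (X (Suc j) \<omega>)) - real t * \<mu> 2) / real t \<le> ?d"
      by (simp add: C_def)
    then show ?thesis using that by (simp add: pos_divide_le_eq not_less mult.commute del: sum_of_bool_eq)
  qed
  have S_le: "S \<le> enat i \<longleftrightarrow> (\<exists>t\<in>{1..i}. C t)" for i
  proof
    assume le: "S \<le> enat i"
    show "\<exists>t\<in>{1..i}. C t"
    proof (rule ccontr)
      assume "\<not> (\<exists>t\<in>{1..i}. C t)"
      then have "Suc i \<le> t" if "t \<ge> 1" "C t" for t
        using that by (cases "t \<le> i") auto
      then have "enat (Suc i) \<le> S" unfolding S_def by (intro Inf_greatest) auto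
      from this le have "enat (Suc i) \<le> enat i" by (rule order_trans)
      then show False by simp
    qed
  next
    assume "\<exists>t\<in>{1..i}. C t"
    then obtain t where "t \<ge> 1" "t \<le> i" "C t" by auto
    then have "S \<le> enat t" unfolding S_def by (intro Inf_lower) auto
    also have "enat t \<le> enat i" using \<open>t \<le> i\<close> by simp
    finally show "S \<le> enat i" .
  qed
  have sigma: "sigma_stop \<mu> X T \<omega> = the_enat (min (enat T) S)"
    unfolding sigma_stop_def S_def C_def ..
  obtain n where n: "min (enat T) S = enat n" using enat_ile[OF min.cobounded1] by blast
  then have "n \<le> T" by (metis enat_ord_simps(1) min.cobounded1)
  have iff: "i < n \<longleftrightarrow> stays_above (\<mu> 2) ?d (\<lambda>j. X (Suc j) \<omega>) i" if "i < T" for i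
  proof -
    have "i < n \<longleftrightarrow> \<not> min (enat T) S \<le> enat i" unfolding n by (simp add: not_le)
    also have "\<dots> \<longleftrightarrow> \<not> (\<exists>t\<in>{1..i}. C t)"
      using that S_le[of i] by (simp add: min_le_iff_disj)
    also have "\<dots> \<longleftrightarrow> stays_above (\<mu> 2) ?d (\<lambda>j. X (Suc j) \<omega>) i"
      unfolding stays_above_def using C by auto
    finally show ?thesis .
  qed
  have "(\<Sum>i<T. of_bool (stays_above (\<mu> 2) ?d (\<lambda>j. X (Suc j) \<omega>) i)) = (\<Sum>i<T. of_bool (i < n) :: real)"
    by (intro sum.cong refl) (simp add: iff)
  also have "\<dots> = real (card ({..<T} \<inter> {i. i < n}))" by simp
  also have "{..<T} \<inter> {i. i < n} = {..<n}" using \<open>n \<le> T\<close> by auto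
  finally show ?thesis using n sigma by simp
qed

lemma expectation_sigma_stop:
  assumes "prob_space P" and p: "0 \<le> \<mu> 2" "\<mu> 2 \<le> 1"
    and indep: "prob_space.indep_vars P (\<lambda>_. count_space UNIV) X {1..}"
    and bern: "\<And>t. t \<ge> 1 \<Longrightarrow>
      distr P (count_space UNIV) (X t) = measure_pmf (bernoulli_pmf (\<mu> 2))"
  shows "(\<integral>\<omega>. real (sigma_stop \<mu> X T \<omega>) \<partial>P) =
    (\<Sum>i<T. \<Sum>y\<in>above_patterns (\<mu> 2) ((\<mu> 1 - \<mu> 2) / 2) i. pattern_weight (\<mu> 2) y i)"
proof -
  interpret P: prob_space P by fact
  let ?d = "(\<mu> 1 - \<mu> 2) / 2"
  have X: "X t \<in> P \<rightarrow>\<^sub>M count_space UNIV" if "t \<ge> 1" for t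
    using indep that by (auto simp: P.indep_vars_def)
  have X_sets: "{\<omega> \<in> space P. X t \<omega> = b} \<in> sets P" if "t \<ge> 1" for t b
    using measurable_sets[OF X[OF that], of "{b}"] by (simp add: vimage_def Int_def conj_commute)
  have X_prob: "P.prob {\<omega> \<in> space P. X t \<omega> = b} = (if b then \<mu> 2 else 1 - \<mu> 2)" if "t \<ge> 1" for t b
  proof -
    have "P.prob {\<omega> \<in> space P. X t \<omega> = b} = measure (distr P (count_space UNIV) (X t)) {b}"
      by (subst measure_distr[OF X[OF that]]) (simp_all add: vimage_def Int_def conj_commute)
    also have "\<dots> = pmf (bernoulli_pmf (\<mu> 2)) b" unfolding bern[OF that] by (simp add: measure_pmf_single)
    finally show ?thesis using p by (cases b) auto
  qed
  have sets: "{\<omega> \<in> space P. \<forall>j<i. X (Suc j) \<omega> = y j} \<in> sets P" for i y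
  proof -
    have "{\<omega> \<in> space P. \<forall>j\<in>{..<i}. X (Suc j) \<omega> = y j} \<in> sets P"
    proof (rule sets.sets_Collect_finite_All)
      fix j assume "j \<in> {..<i}"
      show "{\<omega> \<in> space P. X (Suc j) \<omega> = y j} \<in> sets P" by (rule X_sets) simp
    qed simp
    then show ?thesis by (simp only: Ball_def lessThan_iff)
  qed
  have pattern: "P.prob {\<omega> \<in> space P. \<forall>j<i. X (Suc j) \<omega> = y j} = pattern_weight (\<mu> 2) y i" for i y
  \<comment> \<open>The product rule for independent variables is stated for a nonempty index
    set.\<close>
  proof (cases "i = 0")
    case True
    then show ?thesis by (simp add: pattern_weight_def P.prob_space)
  next
    case False
    have "{\<omega> \<in> space P. \<forall>j<i. X (Suc j) \<omega> = y j} = (\<Inter>t\<in>Suc ` {..<i}. X t -` {y (t - 1)} \<inter> space P)"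
      using False by auto
    also have "P.prob \<dots> = (\<Prod>t\<in>Suc ` {..<i}. P.prob (X t -` {y (t - 1)} \<inter> space P))"
      by (rule P.indep_varsD[OF indep]) (use False in auto)
    also have "\<dots> = (\<Prod>t\<in>Suc ` {..<i}. if y (t - 1) then \<mu> 2 else 1 - \<mu> 2)"
    proof (rule prod.cong[OF refl])
      fix t assume "t \<in> Suc ` {..<i}"
      then have "t \<ge> 1" by auto
      from X_prob[OF this, of "y (t - 1)"]
      show "P.prob (X t -` {y (t - 1)} \<inter> space P) = (if y (t - 1) then \<mu> 2 else 1 - \<mu> 2)"
        by (simp add: vimage_def Int_def conj_commute)
    qed
    also have "\<dots> = pattern_weight (\<mu> 2) y i" by (simp add: prod.reindex pattern_weight_def)
    finally show ?thesis .
  qed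
  let ?B = "\<lambda>i. {\<omega> \<in> space P. stays_above (\<mu> 2) ?d (\<lambda>j. X (Suc j) \<omega>) i}"
  have B: "?B i \<in> sets P"
    "P.prob (?B i) = (\<Sum>y\<in>above_patterns (\<mu> 2) ?d i. pattern_weight (\<mu> 2) y i)" for i
    by (rule P.measure_stays_above(1)[OF sets], subst P.measure_stays_above(2)[OF sets], simp only: pattern)
  have "(\<integral>\<omega>. real (sigma_stop \<mu> X T \<omega>) \<partial>P) = (\<integral>\<omega>. (\<Sum>i<T. indicator (?B i) \<omega>) \<partial>P)"
    unfolding real_sigma_stop_eq
    by (intro Bochner_Integration.integral_cong sum.cong refl) (auto simp: indicator_def)
  also have "\<dots> = (\<Sum>i<T. P.prob (?B i))"
    using B(1) by (subst Bochner_Integration.integral_sum) (auto simp: P.emeasure_eq_measure)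
  finally show ?thesis by (simp only: B(2))
qed

section \<open>Good starts and the law of the rewards that follow them\<close>

locale ucb_bandit = two_armed_bernoulli_bandit M MU U A R \<mu>
  for M :: "'w measure" and MU :: "'u measure" and U A R and \<mu> :: "nat \<Rightarrow> real" +
  assumes means: "0 < \<mu> 2" "\<mu> 2 < \<mu> 1" "\<mu> 1 < 1"
    and ucb: "follows_UCB M A R"
begin

text \<open>Fixing the value \<open>s\<close> of the random start allows the past at a deterministic
  time to be used, in place of a strong Markov property at \<open>tau\<close>.\<close>

definition good_start :: "nat \<Rightarrow> real \<Rightarrow> nat \<Rightarrow> nat \<Rightarrow> 'w set" where
  "good_start T \<epsilon> k s = {\<omega> \<in> space M. tau A k \<omega> = enat s \<and> good_time \<mu> T \<epsilon> A R s \<omega>}"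

lemma good_start_sets: "good_start T \<epsilon> (Suc k) s \<in> sets (F s)"
proof -
  have "good_start T \<epsilon> (Suc k) s =
      {\<omega> \<in> space M. tau A (Suc k) \<omega> = enat s} \<inter> {\<omega> \<in> space M. good_time \<mu> T \<epsilon> A R s \<omega>}"
    by (auto simp: good_start_def)
  then show ?thesis using sets_tau_eq sets_good_time by auto
qed

lemma good_start_disjoint: "disjoint_family (good_start T \<epsilon> k)"
  by (auto simp: disjoint_family_on_def good_start_def)

text \<open>Almost every path has good starts from some episode on, so the indicators tend to 1 and
  dominated convergence applies.\<close>

lemma prob_good_start_tendsto:
  assumes "\<epsilon> > 0"
  shows "(\<lambda>k. prob (\<Union>s. good_start T \<epsilon> (Suc k) s)) \<longlonglongrightarrow> 1"
proof -
  let ?G = "\<lambda>k. \<Union>s. good_start T \<epsilon> (Suc k) s"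
  have G: "?G k \<in> sets M" for k
    using good_start_sets past_subset by (intro sets.countable_UN) blast
  have "AE \<omega> in M. (\<lambda>t. emp_mean A R 1 t \<omega>) \<longlonglongrightarrow> \<mu> 1" "AE \<omega> in M. (\<lambda>t. emp_mean A R 2 t \<omega>) \<longlonglongrightarrow> \<mu> 2"
    using means by (auto intro!: AE_emp_mean_tendsto ucb)
  then have ev: "AE \<omega> in M. (\<lambda>k. indicator (?G k) \<omega> :: real) \<longlonglongrightarrow> 1"
    using AE_space
  proof eventually_elim
    case (elim \<omega>)
    interpret ucb_path A R \<omega> by (rule ucb_path_if_follows_UCB[OF ucb elim(3)])
    have "eventually (\<lambda>k. \<exists>s. tau A k \<omega> = enat s \<and> good_time \<mu> T \<epsilon> A R s \<omega>) at_top"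
      by (rule eventually_good_tau) (use elim means assms in auto)
    then have "eventually (\<lambda>k. \<exists>s. tau A (Suc k) \<omega> = enat s \<and> good_time \<mu> T \<epsilon> A R s \<omega>) at_top"
      by (subst eventually_sequentially_Suc)
    then have "eventually (\<lambda>k. indicator (?G k) \<omega> = (1 :: real)) at_top"
      by eventually_elim (use elim(3) in \<open>auto simp: good_start_def indicator_def\<close>)
    then show ?case by (rule tendsto_eventually)
  qed
  have "(\<lambda>k. \<integral>\<omega>. indicator (?G k) \<omega> \<partial>M) \<longlonglongrightarrow> (\<integral>\<omega>. (1 :: real) \<partial>M)"
  proof (rule integral_dominated_convergence[where w = "\<lambda>_. 1"])
    show "(\<lambda>\<omega>. indicator (?G k) \<omega> :: real) \<in> borel_measurable M" for k
      by (rule borel_measurable_indicator[OF G])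
    show "AE \<omega> in M. norm (indicator (?G k) \<omega> :: real) \<le> 1" for k
      by (rule AE_I2) (simp add: indicator_def)
  qed (use ev in simp_all)
  then show ?thesis using G by (simp add: prob_space)
qed

text \<open>Having followed the pattern for \<open>i\<close> rewards forces arm 2 at
  \<open>s + i\<close>, and this event lies in \<open>F (s + i)\<close>; conditioning on it
  therefore contributes one more Bernoulli factor with mean \<open>\<mu> 2\<close>.\<close>

lemma prob_reward_pattern:
  assumes margin: "\<And>y i. stays_above (\<mu> 2) ((\<mu> 1 - \<mu> 2) / 2) y i \<Longrightarrow> 1 \<le> i \<Longrightarrow> i \<le> T \<Longrightarrow>
      real i * ((\<mu> 1 - \<mu> 2) / 2) + \<delta> \<le> (\<Sum>j<i. of_bool (y j)) - real i * \<mu> 2"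
    and \<epsilon>: "3 / 2 * real T * \<epsilon> < \<delta>"
  shows "stays_above (\<mu> 2) ((\<mu> 1 - \<mu> 2) / 2) y i \<Longrightarrow> i \<le> T \<Longrightarrow>
    prob {\<omega> \<in> good_start T \<epsilon> (Suc k) s. \<forall>j<i. R (s + j) \<omega> = y j} =
      pattern_weight (\<mu> 2) y i * prob (good_start T \<epsilon> (Suc k) s)"
proof (induction i)
  case 0
  then show ?case by (simp add: pattern_weight_def)
next
  case (Suc i)
  let ?H = "good_start T \<epsilon> (Suc k) s"
  let ?E = "{\<omega> \<in> ?H. \<forall>j<i. R (s + j) \<omega> = y j}"
  have above: "stays_above (\<mu> 2) ((\<mu> 1 - \<mu> 2) / 2) y i" using Suc.prems(1) by (rule stays_above_mono) simp
  show ?case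
  proof (cases "s \<ge> 1")
    case False
    have "\<omega> \<notin> ?H" for \<omega>
      using tau_SucD(1)[of A k \<omega> s] False unfolding good_start_def by auto
    then have "?H = {}" by blast
    then show ?thesis by simp
  next
    case s: True
    have "?E = ?H \<inter> {\<omega> \<in> space M. \<forall>j\<in>{..<i}. R (s + j) \<omega> = y j}"
      by (auto simp: good_start_def)
    also have "\<dots> \<in> sets (F (s + i))"
    proof (rule sets.Int)
      show "?H \<in> sets (F (s + i))" using good_start_sets past_mono[of s "s + i"] by auto
      show "{\<omega> \<in> space M. \<forall>j\<in>{..<i}. R (s + j) \<omega> = y j} \<in> sets (F (s + i))"
      proof -
        have "{\<omega> \<in> space (F (s + i)). \<forall>j\<in>{..<i}. R (s + j) \<omega> = y j} \<in> sets (F (s + i))"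
        proof (rule sets.sets_Collect_finite_All)
          fix j assume "j \<in> {..<i}"
          then show "{\<omega> \<in> space (F (s + i)). R (s + j) \<omega> = y j} \<in> sets (F (s + i))"
            unfolding space_past using s by (intro sets_R_eq) auto
        qed simp
        then show ?thesis by (simp only: space_past)
      qed
    qed
    finally have E: "?E \<in> sets (F (s + i))" .
    have arm: "A (s + i) \<omega> = 2" if "\<omega> \<in> ?E" for \<omega>
    proof -
      have \<omega>: "\<omega> \<in> space M" "tau A (Suc k) \<omega> = enat s" "good_time \<mu> T \<epsilon> A R s \<omega>"
        "\<And>j. j < i \<Longrightarrow> R (s + j) \<omega> = y j" using that by (auto simp: good_start_def)
      interpret ucb_path A R \<omega> by (rule ucb_path_if_follows_UCB[OF ucb \<omega>(1)])
      have "stays_above (\<mu> 2) ((\<mu> 1 - \<mu> 2) / 2) (\<lambda>j. R (s + j) \<omega>) i"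
        using above stays_above_cong[of i y "\<lambda>j. R (s + j) \<omega>"] \<omega>(4) by simp
      then show ?thesis
        using arm_two_persists[OF margin \<epsilon> \<omega>(3) s tau_SucD(2)[OF \<omega>(2)]] Suc.prems(2) by simp
    qed
    have "{\<omega> \<in> ?H. \<forall>j<Suc i. R (s + j) \<omega> = y j} = ?E \<inter> {\<omega> \<in> space M. R (s + i) \<omega> = y i}"
      by (auto simp: good_start_def less_Suc_eq)
    then have "prob {\<omega> \<in> ?H. \<forall>j<Suc i. R (s + j) \<omega> = y j} =
        (if y i then \<mu> 2 else 1 - \<mu> 2) * prob ?E"
      using prob_reward[OF _ E arm] s by simp
    then show ?thesis using Suc.IH[OF above] Suc.prems(2) by (simp add: pattern_weight_def)
  qed
qed

text \<open>After a good start the pull at offset \<open>i\<close> costs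
  \<open>\<mu> 1 - \<mu> 2\<close> whenever the first \<open>i\<close> rewards stay above, and every
  other pull costs at least 0. Summing expectations over offsets recovers the tail sum of
  \<open>sigma_stop\<close>.\<close>

lemma expectation_regret_ge:
  assumes margin: "\<And>y i. stays_above (\<mu> 2) ((\<mu> 1 - \<mu> 2) / 2) y i \<Longrightarrow> 1 \<le> i \<Longrightarrow> i \<le> T \<Longrightarrow>
      real i * ((\<mu> 1 - \<mu> 2) / 2) + \<delta> \<le> (\<Sum>j<i. of_bool (y j)) - real i * \<mu> 2"
    and \<epsilon>: "3 / 2 * real T * \<epsilon> < \<delta>"
  shows "(\<mu> 1 - \<mu> 2) * (\<Sum>i<T. \<Sum>y\<in>above_patterns (\<mu> 2) ((\<mu> 1 - \<mu> 2) / 2) i. pattern_weight (\<mu> 2) y i)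
      * prob (\<Union>s. good_start T \<epsilon> (Suc k) s)
    \<le> (\<integral>\<omega>. (case tau A (Suc k) \<omega> of enat s \<Rightarrow> regret \<mu> A s T \<omega> | \<infinity> \<Rightarrow> 0) \<partial>M)"
proof -
  let ?d = "(\<mu> 1 - \<mu> 2) / 2" and ?H = "good_start T \<epsilon> (Suc k)"
  let ?K = "\<lambda>i s. {\<omega> \<in> ?H s. stays_above (\<mu> 2) ?d (\<lambda>j. R (s + j) \<omega>) i}"
  let ?Q = "\<lambda>i. \<Sum>y\<in>above_patterns (\<mu> 2) ?d i. pattern_weight (\<mu> 2) y i"
  define g where "g = (\<lambda>\<omega>. case tau A (Suc k) \<omega> of enat s \<Rightarrow> regret \<mu> A s T \<omega> | \<infinity> \<Rightarrow> 0)"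
  have s_pos: "s \<ge> 1" if "\<omega> \<in> ?H s" for \<omega> s
    using that tau_SucD(1)[of A k \<omega> s] unfolding good_start_def by auto
  have H_M: "?H s \<in> sets M" for s using good_start_sets past_subset by blast
  have pat_M: "{\<omega> \<in> ?H s. \<forall>j<i. R (s + j) \<omega> = y j} \<in> sets M" for s i y
  proof (cases "s \<ge> 1")
    case True
    have "{\<omega> \<in> ?H s. \<forall>j<i. R (s + j) \<omega> = y j} = ?H s \<inter> {\<omega> \<in> space M. \<forall>j\<in>{..<i}. R (s + j) \<omega> = y j}"
      by (auto simp: good_start_def)
    also have "\<dots> \<in> sets M"
    proof (rule sets.Int[OF H_M], rule sets.sets_Collect_finite_All)
      fix j assume "j \<in> {..<i}"
      show "{\<omega> \<in> space M. R (s + j) \<omega> = y j} \<in> sets M"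
        by (rule subsetD[OF past_subset sets_R_eq[of "s + j" "Suc (s + j)"]]) (use True in auto)
    qed simp
    finally show ?thesis .
  next
    case False
    then have "{\<omega> \<in> ?H s. \<forall>j<i. R (s + j) \<omega> = y j} = {}" using s_pos by auto
    then show ?thesis by (simp only: sets.empty_sets)
  qed
  have K_M: "?K i s \<in> sets M" for i s
    by (rule measure_stays_above(1)[OF pat_M])
  \<comment> \<open>The weight \<open>?Q i\<close> is the same for every \<open>s\<close>, so it
    remains a common factor when the disjoint starts are summed.\<close>
  have prob_K: "prob (\<Union>s. ?K i s) = ?Q i * prob (\<Union>s. ?H s)" if "i < T" for i
  proof -
    have "prob (?K i s) = ?Q i * prob (?H s)" for s
      using that unfolding measure_stays_above(2)[OF pat_M] sum_distrib_right
      by (intro sum.cong refl prob_reward_pattern[OF margin \<epsilon>]) (auto simp: above_patterns_def)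
    moreover have "(\<lambda>s. prob (?K i s)) sums prob (\<Union>s. ?K i s)"
      using K_M by (intro finite_measure_UNION) (auto simp: disjoint_family_on_def good_start_def)
    moreover have "(\<lambda>s. ?Q i * prob (?H s)) sums (?Q i * prob (\<Union>s. ?H s))"
      using H_M good_start_disjoint by (intro sums_mult finite_measure_UNION) auto
    ultimately show ?thesis by (simp only:) (rule sums_unique2)
  qed
  have gap: "0 \<le> \<mu> 1 - \<mu> (A t \<omega>)" "\<mu> 1 - \<mu> (A t \<omega>) \<le> 1" if "t \<ge> 1" "\<omega> \<in> space M" for t \<omega>
    using arm_in[OF that] means by auto
  have g_cases: "\<exists>s\<ge>1. tau A (Suc k) \<omega> = enat s \<and> g \<omega> = regret \<mu> A s T \<omega>" if "\<omega> \<in> space M" for \<omega>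
  proof -
    interpret ucb_path A R \<omega> by (rule ucb_path_if_follows_UCB[OF ucb that])
    obtain s where s: "tau A (Suc k) \<omega> = enat s" using tau_finite by blast
    then show ?thesis using tau_SucD(1)[OF s] by (intro exI[of _ s]) (auto simp: g_def)
  qed
  have g_bound: "0 \<le> g \<omega>" "g \<omega> \<le> real T" if \<omega>: "\<omega> \<in> space M" for \<omega>
  proof -
    obtain s where s: "s \<ge> 1" "g \<omega> = regret \<mu> A s T \<omega>" using g_cases[OF \<omega>] by blast
    show "0 \<le> g \<omega>" unfolding s(2) regret_def by (intro sum_nonneg gap) (use s \<omega> in auto)
    have "g \<omega> \<le> (\<Sum>i<T. 1)" unfolding s(2) regret_def by (intro sum_mono gap) (use s \<omega> in auto)
    then show "g \<omega> \<le> real T" by simp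
  qed
  have g_M: "g \<in> borel_measurable M"
  proof -
    have tau_M: "tau A (Suc k) \<in> M \<rightarrow>\<^sub>M count_space UNIV"
    proof (subst measurable_count_space_eq2_countable, intro conjI ballI)
      fix e :: enat
      show "tau A (Suc k) -` {e} \<inter> space M \<in> sets M"
      proof (cases e)
        case (enat s)
        have "tau A (Suc k) -` {e} \<inter> space M = {\<omega> \<in> space M. tau A (Suc k) \<omega> = enat s}"
          using enat by auto
        then show ?thesis using sets_tau_eq[of k s] past_subset by auto
      next
        case infinity
        have "tau A (Suc k) -` {e} \<inter> space M = {}" using g_cases infinity by fastforce
        then show ?thesis by simp
      qed
    qed simp
    \<comment> \<open>The guard \<open>s \<ge> 1\<close> is there because measurability of the arms
      is known only from time 1 on; it agrees with \<open>g\<close> since every start is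
      positive.\<close>
    define f where "f = (\<lambda>e \<omega>. case e of enat s \<Rightarrow> if s \<ge> 1 then regret \<mu> A s T \<omega> else 0 | \<infinity> \<Rightarrow> 0)"
    have "(\<lambda>\<omega>. f e \<omega>) \<in> borel_measurable M" for e
    proof (cases e)
      case (enat s)
      have "(\<lambda>\<omega>. \<mu> (A (s + i) \<omega>)) \<in> borel_measurable M" if "s \<ge> 1" for i
        by (rule measurable_compose[OF measurable_A_M]) (use that in auto)
      then show ?thesis unfolding f_def regret_def using enat by (cases "s \<ge> 1") auto
    qed (simp add: f_def)
    then have "(\<lambda>\<omega>. f (tau A (Suc k) \<omega>) \<omega>) \<in> borel_measurable M"
      by (rule measurable_compose_countable[OF _ tau_M])
    also have "(\<lambda>\<omega>. f (tau A (Suc k) \<omega>) \<omega>) \<in> borel_measurable M \<longleftrightarrow> ?thesis"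
      by (rule measurable_cong) (use g_cases in \<open>force simp: f_def\<close>)
    finally show ?thesis .
  qed
  have int_g: "integrable M g"
    by (rule integrable_const_bound[where B = "real T"]) (use g_M g_bound in auto)
  have UK_M: "(\<Union>s. ?K i s) \<in> sets M" for i using K_M by auto
  have le: "(\<mu> 1 - \<mu> 2) * (\<Sum>i<T. indicator (\<Union>s. ?K i s) \<omega>) \<le> g \<omega>" if \<omega>: "\<omega> \<in> space M" for \<omega>
  proof -
    obtain s where s: "s \<ge> 1" "tau A (Suc k) \<omega> = enat s" "g \<omega> = regret \<mu> A s T \<omega>"
      using g_cases[OF \<omega>] by blast
    interpret ucb_path A R \<omega> by (rule ucb_path_if_follows_UCB[OF ucb \<omega>])
    have "(\<mu> 1 - \<mu> 2) * indicator (\<Union>s. ?K i s) \<omega> \<le> \<mu> 1 - \<mu> (A (s + i) \<omega>)" if i: "i < T" for i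
    proof (cases "\<omega> \<in> (\<Union>s. ?K i s)")
      case True
      then have "good_time \<mu> T \<epsilon> A R s \<omega>" "stays_above (\<mu> 2) ?d (\<lambda>j. R (s + j) \<omega>) i"
        using s by (auto simp: good_start_def)
      then have "A (s + i) \<omega> = 2"
        using arm_two_persists[OF margin \<epsilon> _ s(1) tau_SucD(2)[OF s(2)]] i by simp
      then show ?thesis using True means by simp
    next
      case False
      then show ?thesis using gap(1)[of "s + i" \<omega>] s \<omega> by simp
    qed
    then show ?thesis unfolding s(3) regret_def sum_distrib_left by (intro sum_mono) auto
  qed
  have "(\<mu> 1 - \<mu> 2) * (\<Sum>i<T. ?Q i) * prob (\<Union>s. ?H s) = (\<mu> 1 - \<mu> 2) * (\<Sum>i<T. prob (\<Union>s. ?K i s))"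
  proof -
    have "(\<Sum>i<T. prob (\<Union>s. ?K i s)) = (\<Sum>i<T. ?Q i) * prob (\<Union>s. ?H s)"
      by (subst sum_distrib_right, intro sum.cong refl prob_K) simp
    then show ?thesis by (simp only: mult.assoc)
  qed
  also have "\<dots> = (\<integral>\<omega>. (\<mu> 1 - \<mu> 2) * (\<Sum>i<T. indicator (\<Union>s. ?K i s) \<omega>) \<partial>M)"
    using UK_M by (simp add: Bochner_Integration.integral_sum emeasure_eq_measure)
  also have "\<dots> \<le> (\<integral>\<omega>. g \<omega> \<partial>M)"
    using UK_M by (intro integral_mono int_g le) (auto simp: emeasure_eq_measure)
  finally show ?thesis by (simp add: g_def)
qed

end

theorem theorem13:
  fixes \<mu> :: "nat \<Rightarrow> real"
    and M :: "'w measure" and MU :: "'u measure"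
    and U :: "'w \<Rightarrow> 'u" and A :: "nat \<Rightarrow> 'w \<Rightarrow> nat" and R :: "nat \<Rightarrow> 'w \<Rightarrow> bool"
    and P :: "'v measure" and X :: "nat \<Rightarrow> 'v \<Rightarrow> bool"
    and T :: nat
  assumes means: "0 < \<mu> 2" "\<mu> 2 < \<mu> 1" "\<mu> 1 < 1"
    and bandit: "two_armed_bernoulli_bandit M MU U A R \<mu>"
    and ucb: "follows_UCB M A R"
    and prob_P: "prob_space P"
    and X_indep: "prob_space.indep_vars P (\<lambda>_. count_space UNIV) X {1..}"
    and X_bernoulli: "\<And>t. t \<ge> 1 \<Longrightarrow>
      distr P (count_space UNIV) (X t) = measure_pmf (bernoulli_pmf (\<mu> 2))"
    and T: "T \<ge> 1"
  shows "RegExp M \<mu> A T \<ge> ereal ((\<mu> 1 - \<mu> 2) * (\<integral>\<omega>. real (sigma_stop \<mu> X T \<omega>) \<partial>P))"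
proof -
  interpret ucb_bandit M MU U A R \<mu>
    by (intro ucb_bandit.intro bandit ucb_bandit_axioms.intro means ucb)
  obtain \<delta> where "\<delta> > 0" and margin: "\<And>y i. stays_above (\<mu> 2) ((\<mu> 1 - \<mu> 2) / 2) y i \<Longrightarrow> 1 \<le> i \<Longrightarrow> i \<le> T \<Longrightarrow>
      real i * ((\<mu> 1 - \<mu> 2) / 2) + \<delta> \<le> (\<Sum>j<i. of_bool (y j)) - real i * \<mu> 2"
    by (rule stays_above_margin[where p = "\<mu> 2" and d = "(\<mu> 1 - \<mu> 2) / 2" and T = T]) blast
  \<comment> \<open>This makes \<open>3 / 2 * T * \<epsilon>\<close> equal to three quarters of
    \<delta>.\<close>
  define \<epsilon> where "\<epsilon> = \<delta> / (2 * real T)"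
  have \<epsilon>: "\<epsilon> > 0" "3 / 2 * real T * \<epsilon> < \<delta>"
    using T \<open>\<delta> > 0\<close> by (auto simp: \<epsilon>_def)
  define c where "c = (\<mu> 1 - \<mu> 2) * (\<integral>\<omega>. real (sigma_stop \<mu> X T \<omega>) \<partial>P)"
  define reg where "reg k = (\<integral>\<omega>. (case tau A k \<omega> of enat s \<Rightarrow> regret \<mu> A s T \<omega> | \<infinity> \<Rightarrow> 0) \<partial>M)" for k
  define q where "q k = c * prob (\<Union>s. good_start T \<epsilon> k s)" for k
  have "(\<integral>\<omega>. real (sigma_stop \<mu> X T \<omega>) \<partial>P) =
      (\<Sum>i<T. \<Sum>y\<in>above_patterns (\<mu> 2) ((\<mu> 1 - \<mu> 2) / 2) i. pattern_weight (\<mu> 2) y i)"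
    by (rule expectation_sigma_stop[OF prob_P]) (use means X_indep X_bernoulli in simp_all)
  then have "q (Suc k) \<le> reg (Suc k)" for k
    using expectation_regret_ge[OF margin \<epsilon>(2), of k] by (simp only: q_def c_def reg_def)
  \<comment> \<open>The inequality is available at successor indices, which suffices for the
    comparison of upper limits.\<close>
  then have "eventually (\<lambda>k. ereal (q k) \<le> ereal (reg k)) sequentially"
    by (subst eventually_sequentially_Suc[symmetric]) simp
  then have "limsup (\<lambda>k. ereal (q k)) \<le> limsup (\<lambda>k. ereal (reg k))"
    by (rule Limsup_mono)
  moreover have "(\<lambda>k. q (Suc k)) \<longlonglongrightarrow> c * 1"
    unfolding q_def by (intro tendsto_mult tendsto_const prob_good_start_tendsto \<epsilon>)
  then have "(\<lambda>k. ereal (q k)) \<longlonglongrightarrow> ereal c"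
    by (intro tendsto_intros) (simp add: filterlim_sequentially_Suc)
  then have "limsup (\<lambda>k. ereal (q k)) = ereal c"
    by (intro lim_imp_Limsup) simp_all
  ultimately show ?thesis by (simp add: RegExp_def reg_def c_def)
qed

end
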